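(* Let $A$ be a unital commutative complex Banach algebra and $B$ a unital semisimple complex Banach algebra. Let $\mathfrak{A}$ be an open subgroup of $A^{-1}$ and $\mathfrak{B}$ an open subgroup of $B^{-1}$. Suppose that $T:\mathfrak{A}\to\mathfrak{B}$ is a surjective isometry, i.e. $T$ is surjective and $\|T(a)-T(b)\|=\|a-b\|$ for all $a,b\in\mathfrak{A}$. Then the map $a\mapsto (T(e_A))^{-1}T(a)$ on $\mathfrak{A}$ extends to a surjective isometrical real-algebra isomorphism from $A$ onto $B$ (a bijective, real-linear, multiplicative isometry). Moreover, $A$ is semisimple and $B$ is commutative. In particular, $A^{-1}$ is isometrically isomorphic to $B^{-1}$ as a metrizable group.
   Context: $A^{-1}$ denotes the multiplicative group of all invertible elements of a unital Banach algebra $A$, with the metric induced by the norm; $e_A$ is the unit of $A$. Semisimple means that the Jacobson radical is $\{0\}$. Two invertible groups are isometrically isomorphic as metrizable groups if there is a group isomorphism from one onto the other that preserves the norm distance. Unital Banach algebras are complex, have submultiplicative norm, and the unit has norm $1$. The map $T$ is not assumed to be linear or multiplicative. *)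

theory Defs
  imports "HOL-Analysis.Analysis" "HOL-Algebra.Group"
begin

text \<open>
  Unital complex Banach algebras. The class \<open>real_normed_algebra_1\<close> already supplies the
  submultiplicative norm and \<open>norm 1 = 1\<close>; the complex scalar multiplication is required to
  restrict to the real one.
\<close>

class complex_banach_algebra_1 = real_normed_algebra_1 + banach +
  fixes scaleC :: "complex \<Rightarrow> 'a \<Rightarrow> 'a"  (infixr "*\<^sub>C" 75)
  assumes scaleC_add_right: "c *\<^sub>C (x + y) = c *\<^sub>C x + c *\<^sub>C y"
    and scaleC_add_left: "(c + d) *\<^sub>C x = c *\<^sub>C x + d *\<^sub>C x"
    and scaleC_scaleC: "c *\<^sub>C (d *\<^sub>C x) = (c * d) *\<^sub>C x"
    and scaleC_of_real: "complex_of_real r *\<^sub>C x = scaleR r x"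
    and mult_scaleC_left: "(c *\<^sub>C x) * y = c *\<^sub>C (x * y)"
    and mult_scaleC_right: "x * (c *\<^sub>C y) = c *\<^sub>C (x * y)"
    and norm_scaleC: "norm (c *\<^sub>C x) = cmod c * norm x"

definition invertible_group :: "'a::monoid_mult monoid" where
  "invertible_group = units_of \<lparr>carrier = UNIV, mult = (*), one = 1\<rparr>"

lemma carrier_invertible_group:
  "carrier invertible_group = {a :: 'a::monoid_mult. \<exists>b. b * a = 1 \<and> a * b = 1}"
  by (simp add: invertible_group_def units_of_def Units_def)

lemma mult_invertible_group [simp]:
  "x \<otimes>\<^bsub>invertible_group\<^esub> y = (x * y :: 'a::monoid_mult)"
  by (simp add: invertible_group_def units_of_def)

lemma one_invertible_group [simp]: "\<one>\<^bsub>invertible_group\<^esub> = (1 :: 'a::monoid_mult)"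
  by (simp add: invertible_group_def units_of_def)

lemma group_invertible_group: "group (invertible_group :: 'a::monoid_mult monoid)"
  unfolding invertible_group_def
  by (intro monoid.units_group monoidI) (auto simp: mult.assoc)

definition open_subgroup_of_invertibles :: "'a::{monoid_mult, topological_space} set \<Rightarrow> bool" where
  "open_subgroup_of_invertibles H \<longleftrightarrow>
     subgroup H invertible_group \<and> openin (top_of_set (carrier invertible_group)) H"

text \<open>
  In a unital algebra the ring-theoretic left ideals are automatically closed under negation
  and are complex subspaces, so no scalars occur below.
\<close>

definition left_ideal :: "'a::ring_1 set \<Rightarrow> bool" where
  "left_ideal I \<longleftrightarrow>
     0 \<in> I \<and> (\<forall>x\<in>I. \<forall>y\<in>I. x + y \<in> I) \<and> (\<forall>a. \<forall>x\<in>I. a * x \<in> I)"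

definition maximal_left_ideal :: "'a::ring_1 set \<Rightarrow> bool" where
  "maximal_left_ideal M \<longleftrightarrow>
     left_ideal M \<and> M \<noteq> UNIV \<and> (\<forall>J. left_ideal J \<and> M \<subseteq> J \<longrightarrow> J = M \<or> J = UNIV)"

definition jacobson_radical :: "'a::ring_1 set" where
  "jacobson_radical = \<Inter> {M. maximal_left_ideal M}"

definition isometrically_isomorphic ::
    "'a::metric_space monoid \<Rightarrow> 'b::metric_space monoid \<Rightarrow> bool" where
  "isometrically_isomorphic G H \<longleftrightarrow>
     (\<exists>h \<in> iso G H. \<forall>x \<in> carrier G. \<forall>y \<in> carrier G. dist (h x) (h y) = dist x y)"

end

theory Submission
  imports Defs "HOL-Computational_Algebra.Fundamental_Theorem_Algebra"
begin

text \<open>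
  The metric first forces affineness, then the groups force multiplicativity.

  An isometry between open sets preserves midpoints of nearby points (the Mazur-Ulam argument
  with reflections works locally), so it is affine on connected pieces of its domain
  (\<open>isometry_affine_on_connected\<close>). An open subgroup is closed under multiplication by nonzero
  complex numbers, and letting the scalar tend to \<open>0\<close> shows that all these affine maps have the
  same constant term \<open>u\<close>. Their linear parts agree as well: if the linear part at \<open>1\<close> sends \<open>p\<close>
  to \<open>T a - u\<close>, comparing the distances from \<open>a\<close> and from \<open>p\<close> to large scalars shows that the norm
  is constant near \<open>1\<close> in every complex direction \<open>c (p - a)\<close>; as \<open>1\<close> is a vertex of the unit ball
  (\<open>unit_is_vertex\<close>), \<open>p = a\<close>. Hence \<open>T a = \<Phi> a + u\<close> with a surjective real-linear isometry \<open>\<Phi>\<close>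
  (\<open>isometry_between_open_subgroups_affine\<close>).

  A vector by whose real multiples an open subgroup can be translated lies in the radical
  (\<open>translation_invariant_imp_radical\<close>). This applies to \<open>u\<close>, and to the image under \<open>\<Phi>\<close> of
  the radical of \<open>A\<close>. As \<open>B\<close> is semisimple, \<open>u = 0\<close> and \<open>A\<close> is semisimple.

  Put \<open>S = \<Phi>\<^sup>-\<^sup>1\<close>. For a character \<open>\<phi>\<close> of \<open>A\<close>, the functional \<open>f x = \<phi> (S x) / \<phi> (S 1)\<close> on \<open>B\<close> is
  real-linear and does not vanish on the subgroup of \<open>B\<close>. Since \<open>S\<close> is isometric, \<open>f\<close> preserves the
  modulus of scalars (\<open>character_isometry_modulus\<close>), so it is the identity or the conjugation on
  them. A real-linear version of the theorem of Gleason, Kahane and Zelazko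
  (\<open>real_linear_gleason_kahane_zelazko\<close>) makes \<open>f\<close> multiplicative. The characters separate the
  points of the commutative semisimple algebra \<open>A\<close> (\<open>characters_separate\<close>), hence
  \<open>x \<mapsto> (S 1)\<^sup>-\<^sup>1 S x\<close> is multiplicative. It is injective into a commutative algebra, so \<open>B\<close> is
  commutative, and it is the inverse of \<open>\<Psi> = (T 1)\<^sup>-\<^sup>1 \<Phi>\<close>. Finally \<open>\<parallel>x\<parallel> = \<parallel>\<Phi> x\<parallel> = \<parallel>T 1 \<cdot> \<Psi> x\<parallel>\<close>
  with \<open>\<parallel>T 1\<parallel> = 1\<close> gives \<open>\<parallel>x\<parallel> \<le> \<parallel>\<Psi> x\<parallel>\<close>. Conversely, the element \<open>e\<close> with \<open>\<Psi> e = (T 1)\<^sup>-\<^sup>1\<close> has norm \<open>1\<close>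
  and \<open>\<Phi> (e x) = \<Psi> x\<close>, so \<open>\<parallel>\<Psi> x\<parallel> = \<parallel>e x\<parallel> \<le> \<parallel>x\<parallel>\<close>.
\<close>

section \<open>Invertible elements and open subgroups\<close>

lemma invertibleI: "b * a = 1 \<Longrightarrow> a * b = 1 \<Longrightarrow> a \<in> carrier invertible_group"
  by (auto simp: carrier_invertible_group)

lemma invertibleE:
  assumes "a \<in> carrier invertible_group"
  obtains b where "b * a = 1" "a * b = 1"
  using assms by (auto simp: carrier_invertible_group)

lemma invertible_mult:
  assumes "a \<in> carrier invertible_group" "b \<in> carrier invertible_group"
  shows "a * b \<in> carrier invertible_group"
  using group.is_monoid[OF group_invertible_group, THEN monoid.m_closed, OF assms] by simp

lemma invertible_one_plus:
  fixes x :: "'a::{real_normed_algebra_1,banach}"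
  assumes "norm x < 1"
  shows "1 + x \<in> carrier invertible_group"
proof -
  define y where "y = - x"
  have s: "summable (\<lambda>n. y ^ n)"
    using assms by (simp add: y_def complete_algebra_summable_geometric)
  define S where "S = (\<Sum>n. y ^ n)"
  have S: "S = 1 + (\<Sum>n. y ^ Suc n)"
    unfolding S_def using suminf_split_head[OF s] by simp
  have "(\<Sum>n. y ^ Suc n) = y * S"
    unfolding S_def using suminf_mult[OF s, of y] by simp
  moreover have "(\<Sum>n. y ^ Suc n) = S * y"
    unfolding S_def using suminf_mult2[OF s, of y] by (simp add: power_commutes)
  ultimately have "(1 - y) * S = 1" "S * (1 - y) = 1"
    using S by (simp_all add: algebra_simps)
  then show ?thesis
    by (intro invertibleI[of S]) (auto simp: y_def)
qed

text \<open>
  Left multiplication by an invertible element is a homeomorphism. In this form the fact yields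
  both that the invertible elements form an open set and that cosets of open subgroups are open.
\<close>

lemma left_translate_ball:
  fixes a b :: "'a::{real_normed_algebra_1,banach}"
  assumes ab: "a * b = 1" and e: "e > 0"
  shows "\<exists>d>0. \<forall>y. dist y a < d \<longrightarrow> (\<exists>x. norm x < e \<and> y = a * (1 + x))"
proof (intro exI[of _ "e / norm b"] conjI allI impI)
  have "b \<noteq> 0" using ab by auto
  then show "e / norm b > 0" using e by simp
  fix y assume "dist y a < e / norm b"
  then have *: "norm b * norm (y - a) < e"
    using \<open>b \<noteq> 0\<close> by (simp add: dist_norm field_simps)
  have "a * (1 + b * (y - a)) = a + (a * b) * (y - a)" by (simp add: algebra_simps)
  then have "y = a * (1 + b * (y - a))" by (simp add: ab)
  moreover have "norm (b * (y - a)) < e"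
    using * norm_mult_ineq[of b "y - a"] by linarith
  ultimately show "\<exists>x. norm x < e \<and> y = a * (1 + x)" by blast
qed

lemma open_invertibles:
  "open (carrier (invertible_group :: 'a::{real_normed_algebra_1,banach} monoid))"
  unfolding open_dist
proof
  fix a :: 'a assume a: "a \<in> carrier invertible_group"
  then obtain b where "b * a = 1" "a * b = 1" by (rule invertibleE)
  from left_translate_ball[OF this(2) zero_less_one]
  show "\<exists>e>0. \<forall>y. dist y a < e \<longrightarrow> y \<in> carrier invertible_group"
    using a invertible_mult invertible_one_plus by metis
qed

lemma
  assumes "open_subgroup_of_invertibles H"
  shows osg_one: "1 \<in> H"
    and osg_mult: "x \<in> H \<Longrightarrow> y \<in> H \<Longrightarrow> x * y \<in> H"
    and osg_invertible: "x \<in> H \<Longrightarrow> x \<in> carrier invertible_group"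
    and osg_inv: "x \<in> H \<Longrightarrow> y * x = 1 \<Longrightarrow> x * y = 1 \<Longrightarrow> y \<in> H"
proof -
  have S: "subgroup H invertible_group"
    using assms by (simp add: open_subgroup_of_invertibles_def)
  show "1 \<in> H" using subgroup.one_closed[OF S] by simp
  show "x \<in> H \<Longrightarrow> y \<in> H \<Longrightarrow> x * y \<in> H" using subgroup.m_closed[OF S, of x y] by simp
  show inv: "x \<in> carrier invertible_group" if "x \<in> H" for x using subgroup.subset[OF S] that by auto
  assume x: "x \<in> H" and y: "y * x = 1" "x * y = 1"
  have "inv\<^bsub>invertible_group\<^esub> x = y"
    using group.inv_equality[OF group_invertible_group, of y x] inv[OF x] invertibleI[of x y] y by simp
  then show "y \<in> H" using subgroup.m_inv_closed[OF S x] by simp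
qed

lemma osg_power:
  assumes "open_subgroup_of_invertibles H" "x \<in> H"
  shows "x ^ n \<in> H"
  by (induction n) (auto intro: osg_one osg_mult assms)

lemma osg_open:
  fixes H :: "'a::{real_normed_algebra_1,banach} set"
  assumes "open_subgroup_of_invertibles H"
  shows "open H"
  using assms open_invertibles openin_open_trans
  by (auto simp: open_subgroup_of_invertibles_def)

text \<open>
  Cosets of an open subgroup are open, so membership in the subgroup is locally constant on the
  invertible elements. Membership of concrete elements is derived from this by joining them to a
  known member without leaving the invertible elements.
\<close>

lemma osg_connected:
  fixes H :: "'a::{real_normed_algebra_1,banach} set"
  assumes H: "open_subgroup_of_invertibles H"
    and S: "connected S" "S \<subseteq> carrier invertible_group" and a: "a \<in> S" "a \<in> H"
  shows "S \<subseteq> H"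
proof -
  obtain e where e: "e > 0" "\<And>y. dist y 1 < e \<Longrightarrow> y \<in> H"
    using osg_open[OF H] osg_one[OF H] by (auto simp: open_dist)
  have loc: "\<exists>d>0. \<forall>y. dist y x < d \<longrightarrow> (y \<in> H \<longleftrightarrow> x \<in> H)" if x: "x \<in> S" for x
  proof -
    obtain x' where x': "x' * x = 1" "x * x' = 1"
      using S x by (meson invertibleE subsetD)
    obtain d where d: "d > 0" "\<And>y. dist y x < d \<Longrightarrow> \<exists>z. norm z < e \<and> y = x * (1 + z)"
      using left_translate_ball[OF x'(2) e(1)] by blast
    have "y \<in> H \<longleftrightarrow> x \<in> H" if "dist y x < d" for y
    proof -
      obtain z where z: "norm z < e" "y = x * (1 + z)" using d(2)[OF \<open>dist y x < d\<close>] by blast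
      have zH: "1 + z \<in> H" using e(2)[of "1 + z"] z by (simp add: dist_norm)
      obtain w where w: "w * (1 + z) = 1" "(1 + z) * w = 1"
        using osg_invertible[OF H zH] by (rule invertibleE)
      have "w \<in> H" using osg_inv[OF H zH w] .
      moreover have "x = y * w" using z w by (simp add: mult.assoc)
      ultimately show ?thesis using osg_mult[OF H] zH z by metis
    qed
    with d show ?thesis by blast
  qed
  have "(a \<in> H) = (b \<in> H)" if "b \<in> S" for b
    using S(1) a(1) that
  proof (rule connected_local_const[where f = "\<lambda>b. b \<in> H"])
    show "\<forall>x\<in>S. \<forall>\<^sub>F b in at x within S. (x \<in> H) = (b \<in> H)"
      unfolding eventually_at using loc by blast
  qed
  with a show ?thesis by blast
qed

subsection \<open>Complex scalars\<close>

lemma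
  fixes x y :: "'a::complex_banach_algebra_1"
  shows scaleC_one [simp]: "1 *\<^sub>C x = x"
    and scaleC_zero [simp]: "0 *\<^sub>C x = 0"
    and scaleC_zero_right [simp]: "c *\<^sub>C (0::'a) = 0"
    and scaleC_minus_right: "c *\<^sub>C (- x) = - (c *\<^sub>C x)"
    and scaleC_minus_left: "(- c) *\<^sub>C x = - (c *\<^sub>C x)"
    and scaleC_diff_right: "c *\<^sub>C (x - y) = c *\<^sub>C x - c *\<^sub>C y"
    and scaleC_diff_left: "(c - d) *\<^sub>C x = c *\<^sub>C x - d *\<^sub>C x"
proof -
  show "1 *\<^sub>C x = x" using scaleC_of_real[of 1 x] by simp
  interpret r: additive "\<lambda>x::'a. c *\<^sub>C x" by unfold_locales (rule scaleC_add_right)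
  interpret l: additive "\<lambda>c. c *\<^sub>C x" by unfold_locales (rule scaleC_add_left)
  show "0 *\<^sub>C x = 0" "c *\<^sub>C (0::'a) = 0" "c *\<^sub>C (- x) = - (c *\<^sub>C x)"
    "(- c) *\<^sub>C x = - (c *\<^sub>C x)" "c *\<^sub>C (x - y) = c *\<^sub>C x - c *\<^sub>C y"
    "(c - d) *\<^sub>C x = c *\<^sub>C x - d *\<^sub>C x"
    by (rule l.zero r.zero r.minus l.minus r.diff l.diff)+
qed

lemma scaleC_sum_right: "c *\<^sub>C (\<Sum>i\<in>I. f i) = (\<Sum>i\<in>I. c *\<^sub>C (f i :: 'a::complex_banach_algebra_1))"
  by (induction I rule: infinite_finite_induct) (auto simp: scaleC_add_right)

lemma scaleC_sum_left: "(\<Sum>i\<in>I. c i) *\<^sub>C (x::'a::complex_banach_algebra_1) = (\<Sum>i\<in>I. c i *\<^sub>C x)"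
  by (induction I rule: infinite_finite_induct) (auto simp: scaleC_add_left)

lemma scaleC_eq: "c *\<^sub>C (x::'a::complex_banach_algebra_1) = Re c *\<^sub>R x + Im c *\<^sub>R (\<i> *\<^sub>C x)"
proof -
  have "c = complex_of_real (Re c) + complex_of_real (Im c) * \<i>"
    by (simp add: complex_eq mult.commute)
  then show ?thesis
    by (metis scaleC_add_left scaleC_of_real scaleC_scaleC)
qed

lemma scaleC_one_mult: "(c *\<^sub>C 1) * (x::'a::complex_banach_algebra_1) = c *\<^sub>C x"
  by (simp add: mult_scaleC_left)

lemma norm_scaleC_one [simp]: "norm (c *\<^sub>C (1::'a::complex_banach_algebra_1)) = cmod c"
  by (simp add: norm_scaleC)

lemma continuous_scaleC:
  fixes f :: "'b::topological_space \<Rightarrow> complex" and x :: "'a::complex_banach_algebra_1"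
  assumes "continuous_on S f"
  shows "continuous_on S (\<lambda>t. f t *\<^sub>C x)"
  by (subst scaleC_eq) (intro continuous_intros assms)

lemma invertible_scaleC:
  fixes a :: "'a::complex_banach_algebra_1"
  assumes "c \<noteq> 0" "a \<in> carrier invertible_group"
  shows "c *\<^sub>C a \<in> carrier invertible_group"
proof -
  obtain b where "b * a = 1" "a * b = 1" using assms(2) by (rule invertibleE)
  then show ?thesis using assms(1)
    by (intro invertibleI[of "inverse c *\<^sub>C b"])
       (simp_all add: mult_scaleC_left mult_scaleC_right scaleC_scaleC)
qed

lemma invertible_scalar_plus:
  fixes x :: "'a::complex_banach_algebra_1"
  assumes "norm x < cmod c"
  shows "c *\<^sub>C 1 + x \<in> carrier invertible_group"
proof -
  have c: "c \<noteq> 0" using assms by auto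
  have "norm (inverse c *\<^sub>C x) < 1"
    using assms c unfolding norm_scaleC norm_inverse by (simp add: divide_simps)
  then have "c *\<^sub>C (1 + inverse c *\<^sub>C x) \<in> carrier invertible_group"
    by (intro invertible_scaleC c invertible_one_plus)
  then show ?thesis using c by (simp add: scaleC_add_right scaleC_scaleC)
qed

lemma osg_scaleC:
  fixes a :: "'a::complex_banach_algebra_1"
  assumes H: "open_subgroup_of_invertibles H" and a: "a \<in> H" and c: "c \<noteq> 0"
  shows "c *\<^sub>C a \<in> H"
proof -
  have "(\<lambda>c. c *\<^sub>C a) ` (- {0}) \<subseteq> H"
  proof (rule osg_connected[OF H])
    show "connected ((\<lambda>c. c *\<^sub>C a) ` (- {0}))"
      by (intro connected_continuous_image continuous_scaleC continuous_on_id
            connected_punctured_universe) simp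
    show "(\<lambda>c. c *\<^sub>C a) ` (- {0}) \<subseteq> carrier invertible_group"
      using osg_invertible[OF H a] by (auto intro: invertible_scaleC)
    show "a \<in> (\<lambda>c. c *\<^sub>C a) ` (- {0})" by (rule image_eqI[of _ _ 1]) auto
  qed (rule a)
  then show ?thesis using c by blast
qed

lemma osg_scaleR:
  fixes a :: "'a::complex_banach_algebra_1"
  assumes "open_subgroup_of_invertibles H" "a \<in> H" "r \<noteq> 0"
  shows "r *\<^sub>R a \<in> H"
  using osg_scaleC[OF assms(1,2), of "complex_of_real r"] assms(3) by (simp add: scaleC_of_real)

lemma osg_scalar_plus:
  fixes x :: "'a::complex_banach_algebra_1"
  assumes H: "open_subgroup_of_invertibles H" and x: "norm x < cmod c"
  shows "c *\<^sub>C 1 + x \<in> H"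
proof -
  have "ball (c *\<^sub>C 1) (cmod c) \<subseteq> H"
  proof (rule osg_connected[OF H])
    show "ball (c *\<^sub>C (1::'a)) (cmod c) \<subseteq> carrier invertible_group"
    proof
      fix y assume "y \<in> ball (c *\<^sub>C (1::'a)) (cmod c)"
      then have "c *\<^sub>C 1 + (y - c *\<^sub>C 1) \<in> carrier invertible_group"
        by (intro invertible_scalar_plus) (simp add: dist_norm norm_minus_commute)
      then show "y \<in> carrier invertible_group" by simp
    qed
    have c: "c \<noteq> 0" using x by auto
    show "c *\<^sub>C (1::'a) \<in> ball (c *\<^sub>C 1) (cmod c)" using c by simp
    show "c *\<^sub>C (1::'a) \<in> H" using osg_scaleC[OF H osg_one[OF H] c] .
  qed simp
  then show ?thesis using x by (auto simp: subset_iff dist_norm)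
qed

section \<open>A local Mazur-Ulam theorem\<close>

text \<open>
  Vaisala's reflection argument. Let \<open>R\<close> be the reflection in the midpoint \<open>z\<close>. If \<open>h\<close> is an isometry
  of \<open>D\<close> fixing \<open>x\<close> and \<open>y\<close>, then so is \<open>R h\<^sup>-\<^sup>1 R h\<close>, and it moves \<open>z\<close> twice as far as \<open>h\<close> does. Iterating
  would move \<open>z\<close> out of the bounded set \<open>D\<close> unless \<open>z\<close> is fixed. The intersection of two balls is chosen
  for \<open>D\<close> because it is described by the distances to \<open>x\<close> and \<open>y\<close> only, which makes it invariant under
  all maps that occur.
\<close>

lemma fixed_midpoint:
  fixes x y :: "'a::real_normed_vector"
  defines "D \<equiv> cball x (norm (x - y)) \<inter> cball y (norm (x - y))"
    and "z \<equiv> (1/2) *\<^sub>R (x + y)"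
  assumes g: "g ` D = D" "\<And>u v. u \<in> D \<Longrightarrow> v \<in> D \<Longrightarrow> norm (g u - g v) = norm (u - v)"
    and fix_xy: "g x = x" "g y = y"
  shows "g z = z"
proof -
  define R where "R w = x + y - w" for w
  define W where "W = {g. g ` D = D \<and> (\<forall>u\<in>D. \<forall>v\<in>D. norm (g u - g v) = norm (u - v)) \<and> g x = x \<and> g y = y}"
  have xyD: "x \<in> D" "y \<in> D" by (auto simp: D_def dist_norm norm_minus_commute)
  have RD: "R w \<in> D" if "w \<in> D" for w
    using that by (auto simp: D_def R_def dist_norm norm_minus_commute algebra_simps)
  have RR [simp]: "R (R w) = w" for w by (simp add: R_def)
  have Rn: "norm (R u - R v) = norm (u - v)" for u v
    by (simp add: R_def norm_minus_commute)
  have Rxy: "R x = y" "R y = x" by (simp_all add: R_def)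
  have z2: "2 *\<^sub>R z = x + y" by (simp add: z_def)
  have Rz: "R z = z" unfolding R_def z2[symmetric] by (simp add: scaleR_2)
  have zD: "z \<in> D"
  proof -
    have "x - z = (1/2) *\<^sub>R (x - y)" "y - z = (1/2) *\<^sub>R (y - x)"
      by (simp_all add: z_def algebra_simps) (simp_all flip: scaleR_add_left)
    then show ?thesis by (simp add: D_def dist_norm norm_minus_commute)
  qed
  have Rdist: "norm (R u - u) = 2 * norm (u - z)" for u
  proof -
    have "R u - u = 2 *\<^sub>R (z - u)" unfolding R_def scaleR_diff_right z2 by (simp add: scaleR_2)
    then show ?thesis by (simp add: norm_minus_commute)
  qed
  have bound: "norm (h z - z) \<le> 2 * norm (x - y)" if h: "h \<in> W" for h
  proof -
    have "h z \<in> D" using h zD by (auto simp: W_def)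
    then have "norm (h z - x) \<le> norm (x - y)" "norm (z - x) \<le> norm (x - y)"
      using zD by (auto simp: D_def dist_norm norm_minus_commute)
    then show ?thesis using norm_triangle_ineq4[of "h z - x" "z - x"] by simp
  qed
  have step: "\<exists>k\<in>W. norm (k z - z) = 2 * norm (h z - z)" if h: "h \<in> W" for h
  proof -
    have inj: "inj_on h D" using h by (auto simp: W_def inj_on_def) (metis right_minus_eq norm_eq_zero)
    then have bij: "bij_betw h D D" using h by (auto simp: W_def bij_betw_def)
    define hi where "hi = inv_into D h"
    have hi: "bij_betw hi D D" unfolding hi_def by (rule bij_betw_inv_into[OF bij])
    have hhi: "h (hi w) = w" "hi w \<in> D" if "w \<in> D" for w
      using bij_betw_inv_into_right[OF bij] bij_betwE[OF hi] that by (auto simp: hi_def)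
    have hih: "hi (h w) = w" if "w \<in> D" for w
      using bij_betw_inv_into_left[OF bij] that by (auto simp: hi_def)
    have hin: "norm (hi u - hi v) = norm (u - v)" if "u \<in> D" "v \<in> D" for u v
      using h hhi[OF that(1)] hhi[OF that(2)] by (auto simp: W_def) (metis)
    have hD: "h w \<in> D" if "w \<in> D" for w using bij_betwE[OF bij] that by blast
    define k where "k w = R (hi (R (h w)))" for w
    have kD: "k w \<in> D" if "w \<in> D" for w
      unfolding k_def by (intro RD hhi hD that)
    have "k ` D = D"
    proof (intro equalityI subsetI)
      fix w assume w: "w \<in> D"
      have "w = k (hi (R (h (R w))))"
        unfolding k_def by (simp add: hhi hih RD hD w)
      then show "w \<in> k ` D" by (rule image_eqI) (intro hhi RD hD w)
    qed (use kD in blast)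
    moreover have "norm (k u - k v) = norm (u - v)" if "u \<in> D" "v \<in> D" for u v
      using h that unfolding k_def by (simp add: Rn hin RD hD W_def)
    moreover have "hi x = x" "hi y = y" using hih[OF xyD(1)] hih[OF xyD(2)] h by (auto simp: W_def)
    then have "k x = x" "k y = y" using h by (auto simp: k_def Rxy W_def)
    ultimately have "k \<in> W" by (simp add: W_def)
    moreover have "norm (k z - z) = norm (hi (R (h z)) - z)"
      using Rn[of "hi (R (h z))" z] by (simp add: k_def Rz)
    moreover have "\<dots> = norm (R (h z) - h z)"
      using hin[OF RD[OF hD[OF zD]] hD[OF zD]] hih[OF zD] by simp
    ultimately show ?thesis using Rdist by metis
  qed
  have gW: "g \<in> W" using g fix_xy by (simp add: W_def)
  have "\<exists>k\<in>W. norm (k z - z) = 2 ^ n * norm (g z - z)" for n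
  proof (induction n)
    case 0 then show ?case using gW by auto
  next
    case (Suc n)
    then obtain k where k: "k \<in> W" "norm (k z - z) = 2 ^ n * norm (g z - z)" by blast
    from step[OF k(1)] obtain k' where "k' \<in> W" "norm (k' z - z) = 2 * norm (k z - z)" by blast
    with k(2) show ?case by (intro bexI[of _ k']) auto
  qed
  then have le: "2 ^ n * norm (g z - z) \<le> 2 * norm (x - y)" for n
    using bound by metis
  have "norm (g z - z) = 0"
  proof (rule ccontr)
    assume "norm (g z - z) \<noteq> 0"
    then have pos: "norm (g z - z) > 0" by simp
    obtain n where "2 * norm (x - y) / norm (g z - z) < 2 ^ n"
      using real_arch_pow[of 2] by auto
    with le[of n] pos show False by (simp add: field_simps)
  qed
  then show ?thesis by simp
qed

text \<open>
  With \<open>R\<close> and \<open>R'\<close> the reflections in the two midpoints, \<open>R T\<^sup>-\<^sup>1 R' T\<close> fixes \<open>x\<close> and \<open>y\<close>, hence also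
  their midpoint \<open>z\<close>. Therefore \<open>R'\<close> fixes \<open>T z\<close>, and its only fixed point is the midpoint of
  \<open>T x\<close> and \<open>T y\<close>.
\<close>

lemma isometry_midpoint:
  fixes T :: "'a::real_normed_vector \<Rightarrow> 'b::real_normed_vector"
  assumes onto: "T ` U = V"
    and iso: "\<And>u v. u \<in> U \<Longrightarrow> v \<in> U \<Longrightarrow> norm (T u - T v) = norm (u - v)"
    and U: "cball x (norm (x - y)) \<subseteq> U" and V: "cball (T x) (norm (x - y)) \<subseteq> V"
  shows "T ((1/2) *\<^sub>R (x + y)) = (1/2) *\<^sub>R (T x + T y)"
proof -
  define D where "D = cball x (norm (x - y)) \<inter> cball y (norm (x - y))"
  define D' where "D' = cball (T x) (norm (x - y)) \<inter> cball (T y) (norm (x - y))"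
  define z where "z = (1/2) *\<^sub>R (x + y)"
  define Ti where "Ti = inv_into U T"
  define R where "R w = x + y - w" for w
  define R' where "R' w = T x + T y - w" for w
  have xy: "x \<in> U" "y \<in> U" using U by (auto simp: subset_iff dist_norm)
  have nT: "norm (T x - T y) = norm (x - y)" using iso xy by blast
  have inj: "inj_on T U" by (rule inj_onI) (metis iso right_minus_eq norm_eq_zero)
  have DU: "D \<subseteq> U" and DV: "D' \<subseteq> V" using U V by (auto simp: D_def D'_def)
  have TD: "T w \<in> D'" if "w \<in> D" for w
    using that DU xy iso[of x w] iso[of y w] by (auto simp: D_def D'_def dist_norm)
  have TiT: "Ti (T w) = w" if "w \<in> U" for w
    using inv_into_f_f[OF inj that] by (simp add: Ti_def)
  have TTi: "T (Ti w) = w" "Ti w \<in> U" if "w \<in> V" for w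
    using f_inv_into_f[of w T U] inv_into_into[of w T U] that onto by (auto simp: Ti_def)
  have TiD: "Ti w \<in> D" if "w \<in> D'" for w
  proof -
    have w: "w \<in> V" using that DV by blast
    show ?thesis
      using that TTi[OF w] xy iso[of x "Ti w"] iso[of y "Ti w"] by (auto simp: D_def D'_def dist_norm)
  qed
  have RD: "R w \<in> D" if "w \<in> D" for w
    using that by (auto simp: D_def R_def dist_norm norm_minus_commute algebra_simps)
  have RD': "R' w \<in> D'" if "w \<in> D'" for w
    using that by (auto simp: D'_def R'_def dist_norm norm_minus_commute algebra_simps)
  have R [simp]: "R (R w) = w" "R' (R' v) = v" for w v by (simp_all add: R_def R'_def)
  have Tin: "norm (Ti u - Ti v) = norm (u - v)" if "u \<in> V" "v \<in> V" for u v
    using iso[of "Ti u" "Ti v"] TTi that by simp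
  define g where "g w = R (Ti (R' (T w)))" for w
  have "g z = z"
    unfolding z_def
  proof (rule fixed_midpoint)
    show "g ` (cball x (norm (x - y)) \<inter> cball y (norm (x - y))) = cball x (norm (x - y)) \<inter> cball y (norm (x - y))"
      unfolding D_def[symmetric]
    proof (intro equalityI subsetI)
      fix w assume "w \<in> g ` D"
      then show "w \<in> D" by (auto simp: g_def intro!: RD TiD RD' TD)
    next
      fix w assume w: "w \<in> D"
      have "R w \<in> U" "R' (T (R w)) \<in> V" using RD RD' TD w DU DV by blast+
      then have "w = g (Ti (R' (T (R w))))"
        unfolding g_def by (simp add: TTi TiT)
      then show "w \<in> g ` D" by (rule image_eqI) (intro TiD RD' TD RD w)
    qed
    fix u v assume "u \<in> cball x (norm (x - y)) \<inter> cball y (norm (x - y))"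
      "v \<in> cball x (norm (x - y)) \<inter> cball y (norm (x - y))"
    then have uv: "u \<in> D" "v \<in> D" by (auto simp: D_def)
    have "norm (g u - g v) = norm (Ti (R' (T u)) - Ti (R' (T v)))"
      by (simp add: g_def R_def norm_minus_commute)
    also have "\<dots> = norm (R' (T u) - R' (T v))"
      using RD' TD uv DV by (intro Tin) blast+
    also have "\<dots> = norm (T u - T v)" by (simp add: R'_def norm_minus_commute)
    also have "\<dots> = norm (u - v)" using uv DU iso by blast
    finally show "norm (g u - g v) = norm (u - v)" .
  next
    show "g x = x" "g y = y" using TiT xy by (simp_all add: g_def R_def R'_def)
  qed
  then have "R (R (Ti (R' (T z)))) = R z" by (simp add: g_def)
  moreover have z2: "2 *\<^sub>R z = x + y" by (simp add: z_def)
  have "R z = z" unfolding R_def z2[symmetric] by (simp add: scaleR_2)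
  ultimately have eq: "Ti (R' (T z)) = z" by simp
  have "x - z = (1/2) *\<^sub>R (x - y)" "y - z = (1/2) *\<^sub>R (y - x)"
    by (simp_all add: z_def algebra_simps) (simp_all flip: scaleR_add_left)
  then have "z \<in> D" by (simp add: D_def dist_norm norm_minus_commute)
  then have "R' (T z) \<in> V" using RD' TD DV by blast
  then have "R' (T z) = T z" using eq TTi(1) by metis
  then have "2 *\<^sub>R T z = T x + T y" by (simp add: R'_def scaleR_2 algebra_simps)
  then have "(1/2) *\<^sub>R (2 *\<^sub>R T z) = (1/2) *\<^sub>R (T x + T y)" by simp
  then show ?thesis by (simp add: z_def)
qed

lemma additive_isometry_imp_linear:
  fixes f :: "'a::real_normed_vector \<Rightarrow> 'b::real_normed_vector"
  assumes add: "\<And>x y. f (x + y) = f x + f y" and norm_f: "\<And>x. norm (f x) = norm x"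
  shows "linear f"
proof (rule linearI)
  fix r x
  interpret additive f by unfold_locales (rule add)
  have nat: "f (real n *\<^sub>R x) = real n *\<^sub>R f x" for n x
    by (induction n) (auto simp: zero add scaleR_add_left)
  have int: "f (real_of_int n *\<^sub>R x) = real_of_int n *\<^sub>R f x" for n x
    by (cases n rule: int_cases2) (simp_all add: nat minus)
  have rat: "f (q *\<^sub>R x) = q *\<^sub>R f x" if "q \<in> \<rat>" for q
  proof -
    obtain m n where q: "q = real_of_int m / real_of_int n" "n \<noteq> 0"
      using \<open>q \<in> \<rat>\<close> by (elim Rats_cases') auto
    have "real_of_int n *\<^sub>R f (q *\<^sub>R x) = f (real_of_int m *\<^sub>R x)"
      using q int[of n "q *\<^sub>R x"] by simp
    also have "\<dots> = real_of_int n *\<^sub>R (q *\<^sub>R f x)" using q by (simp add: int)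
    finally show ?thesis using q by (metis of_int_0_eq_iff scaleR_left_imp_eq)
  qed
  have "norm (f (r *\<^sub>R x) - r *\<^sub>R f x) \<le> e" if e: "e > 0" for e
  proof -
    define d where "d = e / (2 * norm x + 1)"
    have d: "d > 0" using e by (simp add: d_def add_nonneg_pos)
    obtain q where q: "q \<in> \<rat>" "r < q" "q < r + d"
      using Rats_dense_in_real[of r "r + d"] d by auto
    have "f (r *\<^sub>R x) - r *\<^sub>R f x = f ((r - q) *\<^sub>R x) + (q - r) *\<^sub>R f x"
      using rat[OF q(1)] by (simp add: scaleR_diff_left diff)
    also have "norm \<dots> \<le> norm (f ((r - q) *\<^sub>R x)) + norm ((q - r) *\<^sub>R f x)" by (rule norm_triangle_ineq)
    also have "\<dots> = \<bar>q - r\<bar> * (2 * norm x)" by (simp add: norm_f abs_minus_commute)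
    also have "\<dots> \<le> d * (2 * norm x + 1)" using q d by (intro mult_mono) auto
    also have "\<dots> = e"
    proof -
      have "2 * norm x + 1 > 0" by (simp add: add_nonneg_pos)
      then show ?thesis unfolding d_def by simp
    qed
    finally show ?thesis .
  qed
  then have "norm (f (r *\<^sub>R x) - r *\<^sub>R f x) \<le> 0" by (rule field_le_epsilon[where y=0, simplified])
  then show "f (r *\<^sub>R x) = r *\<^sub>R f x" by simp
qed (rule add)

text \<open>
  Near \<open>x\<close> the increment \<open>f h = T (x + h) - T x\<close> preserves midpoints and vanishes at \<open>0\<close>, so it commutes
  with halving. Hence \<open>2\<^sup>n f (2\<^sup>-\<^sup>n h)\<close> is the same for all large \<open>n\<close> and defines the additive extension of
  \<open>f\<close> to the whole space.
\<close>

lemma isometry_locally_affine: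
  fixes T :: "'a::real_normed_vector \<Rightarrow> 'b::real_normed_vector"
  assumes onto: "T ` U = V" and opn: "open U" "open V"
    and iso: "\<And>u v. u \<in> U \<Longrightarrow> v \<in> U \<Longrightarrow> norm (T u - T v) = norm (u - v)"
    and x: "x \<in> U"
  obtains L e where "linear L" "\<And>h. norm (L h) = norm h" "surj L" "e > 0"
    "\<And>h. norm h < e \<Longrightarrow> x + h \<in> U \<and> T (x + h) = T x + L h"
proof -
  obtain s1 where s1: "s1 > 0" "ball x s1 \<subseteq> U" using opn(1) x by (meson openE)
  obtain s2 where s2: "s2 > 0" "ball (T x) s2 \<subseteq> V" using opn(2) x onto by (metis imageI openE)
  define r where "r = min s1 s2 / 4"
  have r: "r > 0" "3 * r < s1" "3 * r < s2" using s1 s2 by (auto simp: r_def)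
  define f where "f h = T (x + h) - T x" for h
  have U: "x + h \<in> U" if "norm h < 3 * r" for h
    using that r s1(2) by (auto simp: subset_iff dist_norm)
  have V: "T x + h \<in> V" if "norm h < 3 * r" for h
    using that r s2(2) by (auto simp: subset_iff dist_norm)
  have nf: "norm (f h - f k) = norm (h - k)" if "norm h < r" "norm k < r" for h k
    using iso[OF U U, of h k] that r by (simp add: f_def)
  have f0: "f 0 = 0" by (simp add: f_def)
  have mid: "f ((1/2) *\<^sub>R (h + k)) = (1/2) *\<^sub>R (f h + f k)" if hk: "norm h < r" "norm k < r" for h k
  proof -
    have hk2: "norm (h - k) < 2 * r" using norm_triangle_ineq4[of h k] hk by simp
    have "T ((1/2) *\<^sub>R ((x + h) + (x + k))) = (1/2) *\<^sub>R (T (x + h) + T (x + k))"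
    proof (rule isometry_midpoint[OF onto iso])
      show "cball (x + h) (norm (x + h - (x + k))) \<subseteq> U"
      proof
        fix w assume "w \<in> cball (x + h) (norm (x + h - (x + k)))"
        then have "norm (x + h - w) \<le> norm (h - k)" by (simp add: dist_norm)
        then have "norm (w - x) < 3 * r"
          using norm_triangle_ineq4[of h "x + h - w"] hk hk2 by (simp add: algebra_simps)
        from U[OF this] show "w \<in> U" by simp
      qed
      show "cball (T (x + h)) (norm (x + h - (x + k))) \<subseteq> V"
      proof
        fix w assume "w \<in> cball (T (x + h)) (norm (x + h - (x + k)))"
        then have "norm (T (x + h) - w) \<le> norm (h - k)" by (simp add: dist_norm)
        moreover have "norm (T (x + h) - T x) = norm h"
          using nf[OF hk(1), of 0] r by (simp add: f_def)
        ultimately have "norm (w - T x) < 3 * r"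
          using norm_triangle_ineq4[of "T (x + h) - T x" "T (x + h) - w"] hk hk2
          by (simp add: algebra_simps)
        from V[OF this] show "w \<in> V" by simp
      qed
    qed
    moreover have "(1/2) *\<^sub>R ((x + h) + (x + k)) = x + (1/2) *\<^sub>R (h + k)"
      by (simp add: algebra_simps) (simp flip: scaleR_add_left)
    moreover have "(1/2) *\<^sub>R (T (x + h) + T (x + k)) - T x = (1/2) *\<^sub>R (f h + f k)"
    proof -
      have "T x = (1/2) *\<^sub>R (T x + T x)" by (simp flip: scaleR_2)
      then show ?thesis unfolding f_def by (metis add_diff_add scaleR_diff_right)
    qed
    ultimately show ?thesis by (simp add: f_def)
  qed
  have half: "f ((1/2) *\<^sub>R h) = (1/2) *\<^sub>R f h" if "norm h < r" for h
    using mid[OF that, of 0] r f0 by simp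
  define S where "S n h = 2 ^ n *\<^sub>R f ((1/2) ^ n *\<^sub>R h)" for n and h
  have small: "norm ((1/2) ^ n *\<^sub>R h) < r" if "norm h < 2 ^ n * r" for n and h :: 'a
    using that by (simp add: power_divide field_simps)
  have S_Suc: "S (Suc n) h = S n h" if "norm h < 2 ^ n * r" for n h
    using half[OF small[OF that]] by (simp add: S_def)
  have S_add: "S (n + m) h = S n h" if "norm h < 2 ^ n * r" for n m h
  proof (induction m)
    case (Suc m)
    have "norm h < 2 ^ (n + m) * r"
    proof -
      have "(2::real) ^ n * r \<le> 2 ^ (n + m) * r" using r by (intro mult_right_mono power_increasing) auto
      with that show ?thesis by linarith
    qed
    from S_Suc[OF this] Suc show ?case by simp
  qed simp
  have S_eq: "S n h = S m h" if "norm h < 2 ^ n * r" "norm h < 2 ^ m * r" for n m h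
    using S_add[OF that(1), of "m - n"] S_add[OF that(2), of "n - m"] by (cases "n \<le> m") auto
  have ex: "\<exists>n. norm h < 2 ^ n * r" for h :: 'a
    using real_arch_pow[of 2 "norm h / r"] r by (auto simp: field_simps)
  define L where "L h = S (SOME n. norm h < 2 ^ n * r) h" for h
  have L: "L h = S n h" if "norm h < 2 ^ n * r" for n h
    unfolding L_def by (rule S_eq[OF someI_ex[OF ex] that])
  have L_small: "L h = f h" if "norm h < r" for h
    using L[of h 0] that by (simp add: S_def)
  have norm_L: "norm (L h) = norm h" for h
  proof -
    obtain n where n: "norm h < 2 ^ n * r" using ex by blast
    have "norm (f ((1/2) ^ n *\<^sub>R h)) = norm ((1/2) ^ n *\<^sub>R h)"
      using nf[OF small[OF n], of 0] r f0 by simp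
    then show ?thesis using L[OF n] by (simp add: S_def power_divide)
  qed
  have "L (h + k) = L h + L k" for h k
  proof -
    obtain n where n: "norm h + norm k < 2 ^ n * r"
      using real_arch_pow[of 2 "(norm h + norm k) / r"] r
      by (auto simp: field_simps)
    have "norm h < 2 ^ n * r" "norm k < 2 ^ n * r" using n norm_ge_zero[of h] norm_ge_zero[of k] by linarith+
    note hk = this
    have hk': "norm (h + k) < 2 ^ Suc n * r"
    proof -
      have "norm (h + k) < 2 ^ n * r" using n norm_triangle_ineq[of h k] by linarith
      also have "\<dots> \<le> 2 ^ Suc n * r" using r by simp
      finally show ?thesis .
    qed
    have "(1/2) ^ Suc n *\<^sub>R (h + k) = (1/2) *\<^sub>R ((1/2) ^ n *\<^sub>R h + (1/2) ^ n *\<^sub>R k)"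
      by (simp add: scaleR_add_right)
    then have "S (Suc n) (h + k) = S n h + S n k"
      using mid[OF small[OF hk(1)] small[OF hk(2)]] by (simp add: S_def scaleR_add_right)
    then show ?thesis using L[OF hk'] L[OF hk(1)] L[OF hk(2)] by simp
  qed
  then have "linear L" by (rule additive_isometry_imp_linear) (rule norm_L)
  moreover have "surj L"
  proof (rule surjI)
    fix w :: 'b
    show "L (SOME h. L h = w) = w"
    proof (rule someI_ex)
      obtain n where n: "norm w < 2 ^ n * r"
        using real_arch_pow[of 2 "norm w / r"] r by (auto simp: field_simps)
      have small_w: "norm ((1/2) ^ n *\<^sub>R w) < r" using n by (simp add: power_divide field_simps)
      then have "T x + (1/2) ^ n *\<^sub>R w \<in> V" using r by (intro V) linarith
      then obtain u where u: "u \<in> U" "T u = T x + (1/2) ^ n *\<^sub>R w" using onto by (metis imageE)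
      have "norm (u - x) < r" using iso[OF u(1) x] u(2) small_w by simp
      then have "L (u - x) = (1/2) ^ n *\<^sub>R w" using L_small u by (simp add: f_def)
      then have "L (2 ^ n *\<^sub>R (u - x)) = w"
        using linear_scale[OF \<open>linear L\<close>] by (simp add: power_divide)
      then show "\<exists>h. L h = w" by blast
    qed
  qed
  moreover have "x + h \<in> U \<and> T (x + h) = T x + L h" if "norm h < r" for h
    using U[of h] L_small[OF that] that r by (simp add: f_def)
  ultimately show ?thesis using that[OF _ norm_L _ r(1)] by blast
qed

text \<open>
  Two local affine descriptions agree where they overlap, so the pair consisting of the linear part
  and the constant term is locally constant.
\<close>

lemma isometry_affine_on_connected:
  fixes T :: "'a::real_normed_vector \<Rightarrow> 'b::real_normed_vector"
  assumes onto: "T ` U = V" and opn: "open U" "open V"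
    and iso: "\<And>u v. u \<in> U \<Longrightarrow> v \<in> U \<Longrightarrow> norm (T u - T v) = norm (u - v)"
  shows "\<exists>L. (\<forall>x\<in>U. linear (L x) \<and> (\<forall>h. norm (L x h) = norm h) \<and> surj (L x)) \<and>
    (\<forall>S x y. connected S \<and> S \<subseteq> U \<and> x \<in> S \<and> y \<in> S \<longrightarrow> L y = L x \<and> T y = T x + L x (y - x))"
proof -
  have "\<forall>x\<in>U. \<exists>L e. linear L \<and> (\<forall>h. norm (L h) = norm h) \<and> surj L \<and> e > 0 \<and>
      (\<forall>h. norm h < e \<longrightarrow> x + h \<in> U \<and> T (x + h) = T x + L h)"
    using isometry_locally_affine[OF onto opn iso] by metis
  then obtain L e where Le: "\<And>x. x \<in> U \<Longrightarrow> linear (L x) \<and> (\<forall>h. norm (L x h) = norm h) \<and> surj (L x) \<and> e x > 0"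
      "\<And>x h. x \<in> U \<Longrightarrow> norm h < e x \<Longrightarrow> x + h \<in> U \<and> T (x + h) = T x + L x h"
    by metis
  have local: "L (x + h) = L x" if x: "x \<in> U" and h: "norm h < e x" for x h
  proof (rule ext)
    fix k :: 'a
    have lin: "linear (L x)" "linear (L (x + h))" using Le x h by blast+
    have e: "e (x + h) > 0" using Le x h by blast
    \<comment> \<open>With this factor, \<open>t k\<close> is admissible both for the expansion at \<open>x + h\<close> and, after adding \<open>h\<close>, for the one at \<open>x\<close>.\<close>
    define t where "t = min (e (x + h)) (e x - norm h) / (2 * (norm k + 1))"
    have k1: "norm k + 1 > 0" by (simp add: add_nonneg_pos)
    have t: "t > 0" unfolding t_def using e h k1 by (intro divide_pos_pos) auto
    have "norm (t *\<^sub>R k) \<le> t * (norm k + 1)" using t by simp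
    also have "\<dots> = min (e (x + h)) (e x - norm h) / 2" using k1 by (simp add: t_def field_simps)
    finally have tk: "norm (t *\<^sub>R k) < e (x + h)" "norm (t *\<^sub>R k) < e x - norm h"
      using e h by auto
    have "norm (h + t *\<^sub>R k) < e x" using norm_triangle_ineq[of h "t *\<^sub>R k"] tk by linarith
    then have "T (x + (h + t *\<^sub>R k)) = T x + L x (h + t *\<^sub>R k)" using Le x by blast
    moreover have "T ((x + h) + t *\<^sub>R k) = T x + L x h + L (x + h) (t *\<^sub>R k)"
      using Le(2) x h tk(1) by auto
    ultimately have "t *\<^sub>R L x k = t *\<^sub>R L (x + h) k"
      using linear_add[OF lin(1)] linear_scale[OF lin(1)] linear_scale[OF lin(2)]
      by (simp add: add.assoc)
    then show "L (x + h) k = L x k" using t by simp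
  qed
  have "L y = L x \<and> T y = T x + L x (y - x)"
    if S: "connected S" "S \<subseteq> U" "x \<in> S" "y \<in> S" for S x y
  proof -
    define F where "F x = (L x, T x - L x x)" for x
    have "F x = F y"
    proof (rule connected_local_const[OF S(1,3,4)], intro ballI)
      fix a assume "a \<in> S"
      then have a: "a \<in> U" using S by blast
      have "F a = F b" if b: "dist b a < e a" for b
      proof -
        have h: "norm (b - a) < e a" using b by (simp add: dist_norm)
        have "L b = L a" using local[OF a h] by simp
        moreover have "T b = T a + L a (b - a)" using Le(2)[OF a h] by simp
        ultimately show ?thesis using Le(1)[OF a] by (simp add: F_def linear_diff)
      qed
      then show "\<forall>\<^sub>F b in at a within S. F a = F b"
        unfolding eventually_at using Le(1)[OF a] by blast
    qed
    moreover have "linear (L x)" using Le S by blast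
    ultimately show ?thesis by (auto simp: F_def linear_diff algebra_simps)
  qed
  then have "\<forall>S x y. connected S \<and> S \<subseteq> U \<and> x \<in> S \<and> y \<in> S \<longrightarrow> L y = L x \<and> T y = T x + L x (y - x)"
    by (intro allI impI) (elim conjE)
  moreover have "\<forall>x\<in>U. linear (L x) \<and> (\<forall>h. norm (L x h) = norm h) \<and> surj (L x)"
    using Le(1) by blast
  ultimately show ?thesis by (intro exI[of _ L] conjI)
qed

section \<open>Averaging over roots of unity\<close>

lemma binomial_scaleC:
  fixes x :: "'a::complex_banach_algebra_1"
  shows "(1 + c *\<^sub>C x) ^ n = (\<Sum>j\<le>n. (of_nat (n choose j) * c ^ j) *\<^sub>C x ^ j)"
proof (induction n)
  case (Suc n)
  let ?t = "\<lambda>n j. (of_nat (n choose j) * c ^ j) *\<^sub>C x ^ j"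
  have "(c *\<^sub>C x) * (\<Sum>j\<le>n. ?t n j) = (\<Sum>j\<le>n. (of_nat (n choose j) * c ^ Suc j) *\<^sub>C x ^ Suc j)"
    by (simp add: sum_distrib_left mult_scaleC_left mult_scaleC_right scaleC_scaleC mult_ac)
  moreover have "(\<Sum>j\<le>n. ?t n j) = 1 + (\<Sum>j\<le>n. (of_nat (n choose Suc j) * c ^ Suc j) *\<^sub>C x ^ Suc j)"
  proof -
    have "(\<Sum>j\<le>n. ?t n j) = (\<Sum>j\<le>Suc n. ?t n j)" by (simp add: binomial_eq_0)
    also have "\<dots> = ?t n 0 + (\<Sum>j\<le>n. ?t n (Suc j))" by (rule sum.atMost_Suc_shift)
    finally show ?thesis by (simp add: binomial_eq_0)
  qed
  ultimately have "(1 + c *\<^sub>C x) ^ Suc n = 1 + (\<Sum>j\<le>n. ?t (Suc n) (Suc j))"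
    using Suc by (simp add: distrib_right sum.distrib scaleC_add_left algebra_simps)
  also have "\<dots> = (\<Sum>j\<le>Suc n. ?t (Suc n) j)" by (subst sum.atMost_Suc_shift) simp
  finally show ?case .
qed simp

text \<open>
  Averaging extracts the coefficient of \<open>c\<close> from \<open>(1 + c x)\<^sup>n\<close>. It turns a bound on these powers that is
  uniform in \<open>n\<close> into the bound \<open>n \<parallel>x\<parallel> \<le> 1\<close> for every \<open>n\<close>, which forces \<open>x = 0\<close>.
\<close>

lemma roots_of_unity_average:
  fixes x :: "'a::complex_banach_algebra_1"
  assumes m: "n + 1 < m"
  defines "w \<equiv> cis (2 * pi / real m)"
  shows "(\<Sum>k<m. cnj (w ^ k) *\<^sub>C (1 + w ^ k *\<^sub>C x) ^ n) = (of_nat (m * n)) *\<^sub>C x"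
proof -
  have w: "w ^ k = cis (2 * pi * real k / real m)" for k
    unfolding w_def Complex.DeMoivre by (simp add: mult_ac)
  have wm: "w ^ m = 1" using m by (simp add: w)
  have cw: "cnj w * w = 1" by (simp add: w_def cis_cnj cis_mult)
  have geo: "(\<Sum>k<m. (cnj w * w ^ j) ^ k) = (if j = 1 then of_nat m else 0)" if j: "j \<le> n" for j
  proof (cases "j = 1")
    case False
    have "cnj w * w ^ j \<noteq> 1"
    proof
      assume "cnj w * w ^ j = 1"
      then have "w * (cnj w * w ^ j) = w" by simp
      then have "w ^ j = w ^ 1" using cw by (simp add: mult.assoc[symmetric] mult.commute[of w])
      moreover have "inj_on (\<lambda>k. cis (2 * pi * real k / real m)) {..<m}"
        using Complex.bij_betw_roots_unity[of m] m by (simp add: bij_betw_def)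
      from inj_onD[OF this, of j 1] have "w ^ j = w ^ 1 \<Longrightarrow> j = 1" using m j unfolding w by simp
      ultimately have "j = 1" by blast
      with False show False by simp
    qed
    moreover have "(cnj w * w ^ j) ^ m = 1"
    proof -
      have "(cnj w * w ^ j) ^ m = cnj (w ^ m) * (w ^ m) ^ j"
        by (simp add: power_mult_distrib flip: power_mult) (simp add: mult.commute)
      then show ?thesis by (simp add: wm)
    qed
    ultimately show ?thesis using False by (simp add: geometric_sum)
  qed (simp add: cw)
  have "(\<Sum>k<m. cnj (w ^ k) *\<^sub>C (1 + w ^ k *\<^sub>C x) ^ n) =
        (\<Sum>k<m. \<Sum>j\<le>n. (of_nat (n choose j) * (cnj w * w ^ j) ^ k) *\<^sub>C x ^ j)"
    unfolding binomial_scaleC scaleC_sum_right scaleC_scaleC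
    by (intro sum.cong refl arg_cong2[of _ _ _ _ scaleC])
       (simp add: power_mult_distrib mult_ac flip: power_mult)
  also have "\<dots> = (\<Sum>j\<le>n. \<Sum>k<m. (of_nat (n choose j) * (cnj w * w ^ j) ^ k) *\<^sub>C x ^ j)"
    by (rule sum.swap)
  also have "\<dots> = (\<Sum>j\<le>n. (of_nat (n choose j) * (\<Sum>k<m. (cnj w * w ^ j) ^ k)) *\<^sub>C x ^ j)"
    by (simp add: scaleC_sum_left sum_distrib_left)
  also have "\<dots> = (\<Sum>j\<le>n. if j = 1 then of_nat (m * n) *\<^sub>C x else 0)"
    by (intro sum.cong refl) (auto simp: geo mult.commute)
  also have "\<dots> = of_nat (m * n) *\<^sub>C x" by (cases "n = 0") auto
  finally show ?thesis .
qed

lemma bounded_multiples_imp_nonpos: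
  fixes a C :: real
  assumes "\<And>n. real n * a \<le> C"
  shows "a \<le> 0"
proof (rule ccontr)
  assume "\<not> a \<le> 0"
  then obtain n where "C < real n * a" using reals_Archimedean3[of a] by auto
  with assms[of n] show False by simp
qed

text \<open>
  The powers \<open>(1 + c d)\<^sup>n\<close> stay in the unit ball, while their average over the circle \<open>\<bar>c\<bar> = r\<close> against
  the conjugate direction is \<open>n r d\<close>.
\<close>

lemma unit_is_vertex:
  fixes d :: "'a::complex_banach_algebra_1"
  assumes r: "r > 0" and le: "\<And>c. cmod c = r \<Longrightarrow> norm (1 + c *\<^sub>C d) \<le> 1"
  shows "d = 0"
proof -
  have bound: "real n * (r * norm d) \<le> 1" for n
  proof -
    define m where "m = n + 2"
    define w where "w = cis (2 * pi / real m)"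
    define x where "x = complex_of_real r *\<^sub>C d"
    have cw: "cmod (w ^ k) = 1" for k by (simp add: w_def norm_power)
    have "norm (cnj (w ^ k) *\<^sub>C (1 + w ^ k *\<^sub>C x) ^ n) \<le> 1" for k
    proof -
      have "norm (1 + w ^ k *\<^sub>C x) \<le> 1"
        using le[of "w ^ k * complex_of_real r"] cw r by (simp add: x_def scaleC_scaleC norm_mult)
      then have "norm ((1 + w ^ k *\<^sub>C x) ^ n) \<le> 1"
        using norm_power_ineq power_le_one norm_ge_zero order_trans by metis
      then show ?thesis unfolding norm_scaleC complex_mod_cnj cw by simp
    qed
    then have "norm (\<Sum>k<m. cnj (w ^ k) *\<^sub>C (1 + w ^ k *\<^sub>C x) ^ n) \<le> (\<Sum>k<m. 1)"
      by (intro order_trans[OF norm_sum] sum_mono)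
    moreover have "(\<Sum>k<m. cnj (w ^ k) *\<^sub>C (1 + w ^ k *\<^sub>C x) ^ n) = of_nat (m * n) *\<^sub>C x"
      unfolding w_def by (rule roots_of_unity_average) (simp add: m_def)
    ultimately have "real m * (real n * (r * norm d)) \<le> real m * 1"
      using r by (simp add: norm_scaleC x_def norm_mult mult_ac)
    then show ?thesis by (subst (asm) mult_le_cancel_left_pos) (auto simp: m_def)
  qed
  have "r * norm d \<le> 0" by (rule bounded_multiples_imp_nonpos) (rule bound)
  with r show ?thesis by (simp add: mult_le_0_iff)
qed

section \<open>Affineness of isometries between open subgroups\<close>

text \<open>
  On each ray the constant term is the limit at \<open>0\<close>, which does not depend on the ray. The linear
  part \<open>\<Phi>\<close> at \<open>1\<close> is valid on all \<open>l + y\<close> with \<open>\<parallel>y\<parallel> < \<bar>l\<bar>\<close>. For arbitrary \<open>a\<close> in \<open>H\<close> with \<open>T a = \<Phi> p + u\<close>,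
  the distance between the images of \<open>l + p\<close> and \<open>a\<close> is \<open>\<bar>l\<bar>\<close>, so \<open>\<parallel>l + (p - a)\<parallel> = \<bar>l\<bar>\<close> for all large \<open>l\<close>,
  and the vertex property gives \<open>p = a\<close>.
\<close>

theorem isometry_between_open_subgroups_affine:
  fixes T :: "'a::complex_banach_algebra_1 \<Rightarrow> 'b::complex_banach_algebra_1"
  assumes H: "open_subgroup_of_invertibles H" and K: "open_subgroup_of_invertibles K"
    and onto: "T ` H = K"
    and iso: "\<And>a b. a \<in> H \<Longrightarrow> b \<in> H \<Longrightarrow> norm (T a - T b) = norm (a - b)"
  shows "\<exists>\<Phi> u. linear \<Phi> \<and> (\<forall>x. norm (\<Phi> x) = norm x) \<and> surj \<Phi> \<and> (\<forall>a\<in>H. T a = \<Phi> a + u)"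
proof -
  obtain L where L0: "\<forall>x\<in>H. linear (L x) \<and> (\<forall>h. norm (L x h) = norm h) \<and> surj (L x)"
    and conn0: "\<forall>S x y. connected S \<and> S \<subseteq> H \<and> x \<in> S \<and> y \<in> S \<longrightarrow>
                  L y = L x \<and> T y = T x + L x (y - x)"
    using isometry_affine_on_connected[OF onto osg_open[OF H] osg_open[OF K] iso] by blast
  have L: "linear (L x)" "norm (L x h) = norm h" "surj (L x)" if "x \<in> H" for x h
    using L0 that by auto
  have conn: "L y = L x \<and> T y = T x + L x (y - x)"
    if "connected S" "S \<subseteq> H" "x \<in> S" "y \<in> S" for S x y
    using conn0 that by metis
  define c where "c a = T a - L a a" for a
  have ray: "T (t *\<^sub>R a) = c a + t *\<^sub>R L a a" if a: "a \<in> H" and t: "t > 0" for a t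
  proof -
    have "connected ((\<lambda>t. t *\<^sub>R a) ` {0<..})"
      by (intro connected_continuous_image continuous_intros) simp
    moreover have "(\<lambda>t. t *\<^sub>R a) ` {0<..} \<subseteq> H" using osg_scaleR[OF H a] by auto
    moreover have "a \<in> (\<lambda>t. t *\<^sub>R a) ` {0<..}" by (rule image_eqI[of _ _ 1]) auto
    moreover have "t *\<^sub>R a \<in> (\<lambda>t. t *\<^sub>R a) ` {0<..}" using t by blast
    ultimately have "T (t *\<^sub>R a) = T a + L a (t *\<^sub>R a - a)" by (rule conn[THEN conjunct2])
    then show ?thesis using L(1)[OF a] by (simp add: c_def linear_diff linear_scale)
  qed
  \<comment> \<open>\<open>c a\<close> is the limit of \<open>T (t a)\<close> as \<open>t\<close> tends to \<open>0\<close>, and \<open>t a\<close> and \<open>t b\<close> approach each other.\<close>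
  have c_eq: "c a = c b" if a: "a \<in> H" and b: "b \<in> H" for a b
  proof -
    have "norm (c a - c b) \<le> 0 + e" if e: "e > 0" for e
    proof -
      define M where "M = norm (a - b) + norm a + norm b + 1"
      define t where "t = e / M"
      have M: "M > 0" by (simp add: M_def add_nonneg_pos)
      then have t: "t > 0" using e by (simp add: t_def)
      have "c a - c b = (T (t *\<^sub>R a) - T (t *\<^sub>R b)) - t *\<^sub>R L a a + t *\<^sub>R L b b"
        using ray[OF a t] ray[OF b t] by simp
      also have "norm \<dots> \<le> norm (T (t *\<^sub>R a) - T (t *\<^sub>R b)) + norm (t *\<^sub>R L a a) + norm (t *\<^sub>R L b b)"
        using norm_triangle_ineq[of "T (t *\<^sub>R a) - T (t *\<^sub>R b) - t *\<^sub>R L a a" "t *\<^sub>R L b b"]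
          norm_triangle_ineq4[of "T (t *\<^sub>R a) - T (t *\<^sub>R b)" "t *\<^sub>R L a a"] by linarith
      also have "\<dots> = norm (t *\<^sub>R a - t *\<^sub>R b) + t * norm a + t * norm b"
        using iso[of "t *\<^sub>R a" "t *\<^sub>R b"] osg_scaleR[OF H] a b t L(2) by simp
      also have "\<dots> = t * (M - 1)" using t
        unfolding M_def scaleR_diff_right[symmetric] norm_scaleR by (simp add: algebra_simps)
      also have "\<dots> \<le> t * M" using t by simp
      also have "\<dots> = e" using M by (simp add: t_def)
      finally show ?thesis by simp
    qed
    then have "norm (c a - c b) \<le> 0" by (rule field_le_epsilon)
    then show ?thesis by simp
  qed
  define \<Phi> where "\<Phi> = L 1"
  define u where "u = c 1"
  have one: "1 \<in> H" using osg_one[OF H] .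
  have lin: "linear \<Phi>" and norm_\<Phi>: "\<And>x. norm (\<Phi> x) = norm x" and surj: "surj \<Phi>"
    using L[OF one] by (simp_all add: \<Phi>_def)
  have scal: "L (l *\<^sub>C 1) = \<Phi>" if l: "l \<noteq> 0" for l
  proof -
    have "connected ((\<lambda>c. c *\<^sub>C (1::'a)) ` (- {0}))"
      by (intro connected_continuous_image continuous_scaleC continuous_on_id
            connected_punctured_universe) simp
    moreover have "(\<lambda>c. c *\<^sub>C (1::'a)) ` (- {0}) \<subseteq> H" using osg_scaleC[OF H one] by auto
    moreover have "1 \<in> (\<lambda>c. c *\<^sub>C (1::'a)) ` (- {0})" by (rule image_eqI[of _ _ 1]) auto
    moreover have "l *\<^sub>C 1 \<in> (\<lambda>c. c *\<^sub>C (1::'a)) ` (- {0})" using l by blast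
    ultimately show ?thesis unfolding \<Phi>_def by (rule conn[THEN conjunct1])
  qed
  have near_scalar: "T (l *\<^sub>C 1 + y) = u + \<Phi> (l *\<^sub>C 1 + y)" if y: "norm y < cmod l" for l y
  proof -
    have "\<exists>z. norm z < cmod l \<and> x = l *\<^sub>C 1 + z" if "x \<in> ball (l *\<^sub>C 1) (cmod l)" for x :: 'a
      using that by (intro exI[of _ "x - l *\<^sub>C 1"]) (auto simp: dist_norm norm_minus_commute)
    then have "ball (l *\<^sub>C 1) (cmod l) \<subseteq> H" using osg_scalar_plus[OF H] by blast
    moreover have "l \<noteq> 0" using y by auto
    moreover have "l *\<^sub>C (1::'a) \<in> ball (l *\<^sub>C 1) (cmod l)" using \<open>l \<noteq> 0\<close> by simp
    moreover have "l *\<^sub>C 1 + y \<in> ball (l *\<^sub>C 1) (cmod l)" using y by (simp add: dist_norm)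
    ultimately have "L (l *\<^sub>C 1 + y) = \<Phi>"
      using conn[of "ball (l *\<^sub>C 1) (cmod l)" "l *\<^sub>C 1" "l *\<^sub>C 1 + y"] scal by auto
    moreover have "c (l *\<^sub>C 1 + y) = u" unfolding u_def using osg_scalar_plus[OF H y] one by (rule c_eq)
    ultimately show ?thesis by (simp add: c_def algebra_simps)
  qed
  have "T a = \<Phi> a + u" if a: "a \<in> H" for a
  proof -
    obtain p where p: "\<Phi> p = T a - u" using surj by (metis surjD)
    \<comment> \<open>Small enough for the scalar \<open>1/z\<close> to dominate \<open>p\<close>, so that \<open>1/z + p\<close> lies where \<open>T = \<Phi> + u\<close>.\<close>
    define r where "r = inverse (norm p + 1)"
    have r: "r > 0" by (simp add: r_def add_nonneg_pos)
    have "norm (1 + z *\<^sub>C (p - a)) \<le> 1" if z: "cmod z = r" for z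
    proof -
      have z0: "z \<noteq> 0" using z r by auto
      define l where "l = inverse z"
      have l: "norm p < cmod l" unfolding l_def norm_inverse z r_def by simp
      have "norm (T (l *\<^sub>C 1 + p) - T a) = norm (\<Phi> (l *\<^sub>C 1 + p) - \<Phi> p)"
        unfolding near_scalar[OF l] p by (simp add: algebra_simps)
      also have "\<dots> = norm (\<Phi> (l *\<^sub>C 1))" using lin by (simp flip: linear_diff)
      also have "\<dots> = cmod l" by (simp add: norm_\<Phi>)
      finally have "norm (l *\<^sub>C 1 + (p - a)) = cmod l"
        using iso[OF osg_scalar_plus[OF H l] a] by (simp add: algebra_simps)
      then have "cmod z * norm (l *\<^sub>C 1 + (p - a)) = 1" using z0 by (simp add: l_def norm_inverse)
      moreover have "1 + z *\<^sub>C (p - a) = z *\<^sub>C (l *\<^sub>C 1 + (p - a))"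
        using z0 by (simp add: scaleC_add_right scaleC_scaleC l_def)
      ultimately show ?thesis by (simp add: norm_scaleC)
    qed
    from unit_is_vertex[OF r this] have "p = a" by simp
    with p show ?thesis by simp
  qed
  then show ?thesis
    by (intro exI[of _ \<Phi>] exI[of _ u] conjI allI ballI lin norm_\<Phi> surj)
qed

section \<open>Functionals that do not vanish on an open subgroup\<close>

text \<open>
  Newton's identities in terms of the inverse roots, that is, for the polynomial normalised to
  constant term \<open>1\<close>. This form does not refer to the degree.
\<close>

lemma coeffs_from_roots:
  fixes A :: "'a::field multiset"
  assumes "0 \<notin># A"
  defines "P \<equiv> \<Prod>r\<in>#A. [:-r, 1:]"
  defines "S \<equiv> (\<Sum>r\<in>#A. inverse r)" and "Q \<equiv> (\<Sum>r\<in>#A. (inverse r)\<^sup>2)"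
  shows "coeff P 1 = - coeff P 0 * S \<and> 2 * coeff P 2 = coeff P 0 * (S\<^sup>2 - Q)"
  using assms(1) unfolding P_def S_def Q_def
proof (induction A)
  case empty
  show ?case by simp
next
  case (add r A)
  let ?P = "\<Prod>r\<in>#A. [:-r, 1:]" and ?S = "\<Sum>r\<in>#A. inverse r" and ?Q = "\<Sum>r\<in>#A. (inverse r)\<^sup>2"
  have r: "r \<noteq> 0" and A: "0 \<notin># A" using add.prems by auto
  note IH = add.IH[OF A]
  have c: "coeff ([:-r, 1:] * ?P) 0 = - r * coeff ?P 0"
    "coeff ([:-r, 1:] * ?P) 1 = - r * coeff ?P 1 + coeff ?P 0"
    "coeff ([:-r, 1:] * ?P) 2 = - r * coeff ?P 2 + coeff ?P 1"
    by (simp_all add: coeff_pCons numeral_2_eq_2)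
  have 1: "coeff ([:-r, 1:] * ?P) 1 = - coeff ([:-r, 1:] * ?P) 0 * (inverse r + ?S)"
    unfolding c IH[THEN conjunct1] using r by (simp add: algebra_simps)
  have "2 * coeff ([:-r, 1:] * ?P) 2 = - r * (2 * coeff ?P 2) + 2 * coeff ?P 1"
    unfolding c by simp
  also have "\<dots> = - r * (coeff ?P 0 * (?S\<^sup>2 - ?Q)) + 2 * (- coeff ?P 0 * ?S)"
    unfolding IH[THEN conjunct1] IH[THEN conjunct2] ..
  also have "\<dots> = coeff ([:-r, 1:] * ?P) 0 * ((inverse r + ?S)\<^sup>2 - ((inverse r)\<^sup>2 + ?Q))"
    unfolding c using r by (simp add: power2_eq_square algebra_simps)
  finally show ?case using 1 by (simp only: image_mset_add_mset prod_mset.add_mset sum_mset.add_mset)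
qed

text \<open>
  Polarisation gives \<open>f (x y + y x) = 2 f x f y\<close>. When \<open>f x = 0\<close>, the identity
  \<open>(xy - yx)\<^sup>2 + (xy + yx)\<^sup>2 = 2 (x (yxy) + (yxy) x)\<close> shows that \<open>f\<close> kills \<open>(xy - yx)\<^sup>2\<close>, hence \<open>xy - yx\<close>,
  and therefore \<open>xy\<close>.
\<close>

lemma multiplicative_if_square:
  fixes f :: "'b::complex_banach_algebra_1 \<Rightarrow> complex"
  assumes add: "\<And>x y. f (x + y) = f x + f y" and scale: "\<And>c x. f (c *\<^sub>C x) = c * f x"
    and one: "f 1 = 1" and sq: "\<And>x. f (x * x) = f x * f x"
  shows "f (x * y) = f x * f y"
proof -
  interpret additive f by unfold_locales (rule add)
  have jordan: "f (x * y + y * x) = 2 * f x * f y" for x y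
    using sq[of "x + y"] sq[of x] sq[of y] by (simp add: add algebra_simps)
  have zero: "f (x * y) = 0" if x: "f x = 0" for x y
  proof -
    have sum: "f (x * y + y * x) = 0" using jordan[of x y] x by simp
    have "(x * y - y * x) * (x * y - y * x) + (x * y + y * x) * (x * y + y * x) =
        (x * (y * x * y) + (y * x * y) * x) + (x * (y * x * y) + (y * x * y) * x)"
      by (simp add: algebra_simps)
    then have "f ((x * y - y * x) * (x * y - y * x)) + f ((x * y + y * x) * (x * y + y * x)) =
        f (x * (y * x * y) + (y * x * y) * x) + f (x * (y * x * y) + (y * x * y) * x)"
      by (metis add)
    then have "f (x * y - y * x) * f (x * y - y * x) = 0"
      unfolding sq sum jordan[of x "y * x * y"] x by simp
    then have "f (x * y) = f (y * x)" by (simp add: diff)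
    with sum show ?thesis by (simp add: add)
  qed
  have "f (x - f x *\<^sub>C 1) = 0" by (simp add: diff scale one)
  from zero[OF this, of y] show ?thesis by (simp add: left_diff_distrib diff scaleC_one_mult scale)
qed

text \<open>
  The elementary proof of Roitman and Sternfeld. The polynomial \<open>q z = f ((1 - z x)\<^sup>n)\<close> has at most \<open>n\<close>
  roots, all with inverses bounded by \<open>\<parallel>x\<parallel>\<close>. By Newton's identities the sum of the squares of the
  inverse roots is \<open>n\<^sup>2 (f x)\<^sup>2 - n (n - 1) f (x\<^sup>2)\<close>, but its modulus is at most \<open>n \<parallel>x\<parallel>\<^sup>2\<close>. As \<open>n\<close> grows this
  is possible only if \<open>f (x\<^sup>2) = (f x)\<^sup>2\<close>.
\<close>

lemma gleason_kahane_zelazko: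
  fixes f :: "'b::complex_banach_algebra_1 \<Rightarrow> complex"
  assumes add: "\<And>x y. f (x + y) = f x + f y" and scale: "\<And>c x. f (c *\<^sub>C x) = c * f x"
    and one: "f 1 = 1" and nz: "\<And>x n. norm x < 1 \<Longrightarrow> f ((1 - x) ^ n) \<noteq> 0"
  shows "f (x * y) = f x * f y"
proof (rule multiplicative_if_square[OF add scale one])
  fix x
  interpret additive f by unfold_locales (rule add)
  have bound: "real n * cmod (f x * f x - f (x * x)) \<le> (norm x)\<^sup>2 + cmod (f (x * x))" for n
  proof (cases "n = 0")
    case True then show ?thesis by simp
  next
    case n: False
    define a where "a j = of_nat (n choose j) * (- 1) ^ j * f (x ^ j)" for j
    define q where "q = (\<Sum>j\<le>n. monom (a j) j)"
    have coeff_q: "coeff q k = (if k \<le> n then a k else 0)" for k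
    proof -
      have "coeff q k = (\<Sum>j\<le>n. if j = k then a j else 0)" by (simp add: q_def coeff_sum)
      then show ?thesis by (simp add: sum.delta)
    qed
    have poly_q: "poly q z = f ((1 - z *\<^sub>C x) ^ n)" for z
    proof -
      have "(1 - z *\<^sub>C x) ^ n = (\<Sum>j\<le>n. (of_nat (n choose j) * (- z) ^ j) *\<^sub>C x ^ j)"
        using binomial_scaleC[of "- z" x n] by (simp add: scaleC_minus_left)
      then have "f ((1 - z *\<^sub>C x) ^ n) = (\<Sum>j\<le>n. (of_nat (n choose j) * (- z) ^ j) * f (x ^ j))"
        by (simp add: sum scale)
      also have "\<dots> = poly q z"
        unfolding q_def poly_sum poly_monom a_def by (intro sum.cong refl) (simp add: power_minus[of z] mult_ac)
      finally show ?thesis by simp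
    qed
    define A where "A = proots q"
    have q0: "coeff q 0 = 1" by (simp add: coeff_q a_def one)
    then have "q \<noteq> 0" by auto
    have root: "r \<noteq> 0 \<and> cmod (inverse r) \<le> norm x" if "r \<in># A" for r
    proof -
      have "poly q r = 0" using that \<open>q \<noteq> 0\<close> by (simp add: A_def)
      then have "\<not> norm (r *\<^sub>C x) < 1" using nz poly_q by metis
      then have "1 \<le> cmod r * norm x" by (simp add: norm_scaleC)
      moreover from this have "r \<noteq> 0" by auto
      ultimately show ?thesis unfolding norm_inverse by (simp add: divide_simps mult.commute)
    qed
    define S where "S = (\<Sum>r\<in>#A. inverse r)"
    define Q where "Q = (\<Sum>r\<in>#A. (inverse r)\<^sup>2)"
    define P where "P = (\<Prod>r\<in>#A. [:-r, 1:])"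
    define l where "l = lead_coeff q"
    have q_eq: "q = smult l P"
      unfolding P_def A_def l_def by (rule complex_poly_decompose_multiset[symmetric])
    have "0 \<notin># A" using root by blast
    have c: "coeff P 1 = - coeff P 0 * S" "2 * coeff P 2 = coeff P 0 * (S\<^sup>2 - Q)"
      using coeffs_from_roots[OF \<open>0 \<notin># A\<close>] unfolding P_def S_def Q_def by blast+
    have lc: "coeff q k = l * coeff P k" for k unfolding q_eq by simp
    have lc0: "l * coeff P 0 = 1" unfolding lc[symmetric] by (rule q0)
    have "coeff q 1 = - (l * coeff P 0) * S" unfolding lc c(1) by simp
    then have "coeff q 1 = - S" unfolding lc0 by simp
    then have S: "S = of_nat n * f x" using n by (simp add: coeff_q a_def)
    have "2 * coeff q 2 = l * (2 * coeff P 2)" unfolding lc by simp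
    also have "\<dots> = (l * coeff P 0) * (S\<^sup>2 - Q)" unfolding c(2) by (rule mult.assoc[symmetric])
    also have "\<dots> = S\<^sup>2 - Q" unfolding lc0 by simp
    finally have "2 * coeff q 2 = S\<^sup>2 - Q" .
    moreover have "2 * coeff q 2 = of_nat n * (of_nat n - 1) * f (x * x)"
    proof (cases "n \<ge> 2")
      case True
      have "even (n * (n - 1))" by (cases n) auto
      then have "2 * (n choose 2) = n * (n - 1)" unfolding choose_two by (rule dvd_mult_div_cancel)
      then have "of_nat (2 * (n choose 2)) = (of_nat (n * (n - 1)) :: complex)" by (rule arg_cong)
      then have "2 * (of_nat (n choose 2) :: complex) = of_nat n * (of_nat n - 1)"
        using True by (simp add: of_nat_diff)
      then show ?thesis using True by (simp add: coeff_q a_def power2_eq_square)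
    next
      case False
      with n have "n = 1" by simp
      then show ?thesis by (simp add: coeff_q)
    qed
    ultimately have Q: "Q = of_nat n * (of_nat n * (f x * f x - f (x * x)) + f (x * x))"
      using S by (simp add: power2_eq_square algebra_simps)
    have "cmod Q \<le> real (size A) * (norm x)\<^sup>2"
      using root unfolding Q_def
    proof (induction A)
      case (add r A)
      have "cmod ((inverse r)\<^sup>2) \<le> (norm x)\<^sup>2"
        unfolding norm_power using add.prems[of r] by (intro power_mono) auto
      moreover have "cmod (\<Sum>r\<in>#A. (inverse r)\<^sup>2) \<le> real (size A) * (norm x)\<^sup>2"
        using add by simp
      ultimately show ?case
        using norm_triangle_ineq[of "(inverse r)\<^sup>2" "\<Sum>r\<in>#A. (inverse r)\<^sup>2"] by (simp add: algebra_simps)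
    qed simp
    also have "size A \<le> n"
    proof -
      have "size A = degree q" by (simp add: A_def size_proots_complex)
      also have "\<dots> \<le> n" by (rule degree_le) (simp add: coeff_q)
      finally show ?thesis .
    qed
    then have "real (size A) * (norm x)\<^sup>2 \<le> real n * (norm x)\<^sup>2" by (intro mult_right_mono) auto
    finally have "real n * cmod (of_nat n * (f x * f x - f (x * x)) + f (x * x)) \<le> real n * (norm x)\<^sup>2"
      unfolding Q norm_mult by simp
    then have "cmod (of_nat n * (f x * f x - f (x * x)) + f (x * x)) \<le> (norm x)\<^sup>2"
      using n by simp
    moreover have "cmod (of_nat n * (f x * f x - f (x * x))) \<le>
        cmod (of_nat n * (f x * f x - f (x * x)) + f (x * x)) + cmod (f (x * x))"
      by (metis add_diff_cancel_right' norm_triangle_ineq4)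
    ultimately show ?thesis by (simp add: norm_mult)
  qed
  have "cmod (f x * f x - f (x * x)) \<le> 0" by (rule bounded_multiples_imp_nonpos) (rule bound)
  then show "f (x * x) = f x * f x" by simp
qed

text \<open>
  Split \<open>f = g + h\<close> into its complex-linear and its conjugate-linear part. If \<open>\<bar>g b\<bar> = \<bar>h b\<bar>\<close> for some
  \<open>b\<close> in the subgroup, a unimodular multiple of \<open>b\<close> is a zero of \<open>f\<close>; so \<open>\<bar>h\<bar> < \<bar>g\<bar>\<close> holds on everything
  that can be joined to \<open>1\<close>, in particular on \<open>(1 - x)\<^sup>n\<close> for \<open>\<parallel>x\<parallel> < 1\<close>. Thus \<open>g\<close> does not vanish there and is
  multiplicative. For \<open>x\<close> in the kernel of \<open>g\<close> this bounds \<open>\<bar>h ((1 - x)\<^sup>n)\<bar>\<close> by \<open>1\<close> for all \<open>n\<close>, and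
  averaging gives \<open>h x = 0\<close>.
\<close>

lemma real_linear_gleason_kahane_zelazko:
  fixes f :: "'b::complex_banach_algebra_1 \<Rightarrow> complex"
  assumes H: "open_subgroup_of_invertibles H" and lin: "linear f"
    and one: "f 1 = 1" and i: "f (\<i> *\<^sub>C 1) = \<i>" and nz: "\<And>b. b \<in> H \<Longrightarrow> f b \<noteq> 0"
  shows "f (x * y) = f x * f y"
proof -
  have f_scale: "f (c *\<^sub>C x) = of_real (Re c) * f x + of_real (Im c) * f (\<i> *\<^sub>C x)" for c x
    unfolding scaleC_eq[of c x] linear_add[OF lin] linear_scale[OF lin] scaleR_conv_of_real[where 'a = complex]
    by (rule refl)
  have f_scalar: "f (c *\<^sub>C 1) = c" for c
    by (simp add: f_scale[of c 1] one i complex_eq_iff)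
  have f_le: "cmod (f x) \<le> norm x" for x
  proof (rule ccontr)
    assume "\<not> ?thesis"
    then have "(- f x) *\<^sub>C 1 + x \<in> H" by (intro osg_scalar_plus[OF H]) simp
    from nz[OF this] show False by (simp add: linear_add[OF lin] f_scalar)
  qed
  define g where "g x = (f x - \<i> * f (\<i> *\<^sub>C x)) / 2" for x
  define h where "h x = (f x + \<i> * f (\<i> *\<^sub>C x)) / 2" for x
  have f_gh: "f x = g x + h x" for x by (simp add: g_def h_def field_simps)
  have g_add: "g (x + y) = g x + g y" and h_add: "h (x + y) = h x + h y" for x y
    by (simp_all add: g_def h_def scaleC_add_right linear_add[OF lin] field_simps)
  have ii: "f (\<i> *\<^sub>C \<i> *\<^sub>C x) = - f x" for x
    by (simp add: scaleC_scaleC scaleC_minus_left linear_neg[OF lin])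
  have ic: "f (\<i> *\<^sub>C c *\<^sub>C x) = of_real (Re c) * f (\<i> *\<^sub>C x) - of_real (Im c) * f x" for c x
  proof -
    have "\<i> *\<^sub>C c *\<^sub>C x = c *\<^sub>C \<i> *\<^sub>C x" by (simp add: scaleC_scaleC mult.commute)
    then show ?thesis by (simp add: f_scale[of c "\<i> *\<^sub>C x"] ii)
  qed
  have g_scale: "g (c *\<^sub>C x) = c * g x" and h_scale: "h (c *\<^sub>C x) = cnj c * h x" for c x
    unfolding g_def h_def f_scale[of c x] ic by (simp_all add: complex_eq_iff algebra_simps)
  have gh_le: "cmod (g x) \<le> norm x" "cmod (h x) \<le> norm x" for x
  proof -
    have "cmod (\<i> * f (\<i> *\<^sub>C x)) \<le> norm x" using f_le[of "\<i> *\<^sub>C x"] by (simp add: norm_mult norm_scaleC)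
    then show "cmod (g x) \<le> norm x" "cmod (h x) \<le> norm x"
      using f_le[of x] norm_triangle_ineq4[of "f x" "\<i> * f (\<i> *\<^sub>C x)"] norm_triangle_ineq[of "f x" "\<i> * f (\<i> *\<^sub>C x)"]
      by (simp_all add: g_def h_def norm_divide)
  qed
  have "bounded_linear g"
  proof (rule bounded_linear_intro[where K = 1])
    show "g (r *\<^sub>R x) = r *\<^sub>R g x" for r x
      using g_scale[of "of_real r" x] by (simp add: scaleC_of_real scaleR_conv_of_real)
  qed (use g_add gh_le in auto)
  note g_cont = bounded_linear.continuous_on[OF this]
  have "bounded_linear h"
  proof (rule bounded_linear_intro[where K = 1])
    show "h (r *\<^sub>R x) = r *\<^sub>R h x" for r x
      using h_scale[of "of_real r" x] by (simp add: scaleC_of_real scaleR_conv_of_real)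
  qed (use h_add gh_le in auto)
  note h_cont = bounded_linear.continuous_on[OF this]
  interpret h: additive h by unfold_locales (rule h_add)
  interpret g: additive g by unfold_locales (rule g_add)
  have g1: "g 1 = 1" and h1: "h 1 = 0" by (simp_all add: g_def h_def one i)
  have ne: "cmod (g b) \<noteq> cmod (h b)" if b: "b \<in> H" for b
  proof
    assume eq: "cmod (g b) = cmod (h b)"
    have "g b \<noteq> 0"
    proof
      assume "g b = 0"
      then have "f b = 0" using eq by (simp add: f_gh)
      with nz[OF b] show False by simp
    qed
    \<comment> \<open>The rotation that makes the two summands of \<open>f (u b) = u g b + cnj u h b\<close> cancel.\<close>
    define u where "u = csqrt (- h b / g b)"
    have u2: "u * u * g b = - h b" using \<open>g b \<noteq> 0\<close> by (simp add: u_def flip: power2_eq_square)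
    have "cmod (u ^ 2) = cmod (h b) / cmod (g b)" by (simp add: u_def norm_divide)
    also have "\<dots> = 1" using \<open>g b \<noteq> 0\<close> unfolding eq[symmetric] by simp
    finally have "cmod (u ^ 2) = 1" .
    then have "(cmod u)\<^sup>2 = 1" unfolding norm_power .
    then have "cmod u = 1" using norm_ge_zero[of u] unfolding power2_eq_1_iff by linarith
    then have "u * cnj u = 1" by (simp add: complex_norm_square[symmetric])
    moreover have "u * f (u *\<^sub>C b) = u * u * g b + u * cnj u * h b"
      unfolding f_gh g_scale h_scale by (simp add: algebra_simps)
    ultimately have "u * f (u *\<^sub>C b) = 0" unfolding u2 by simp
    moreover have "u \<noteq> 0" using \<open>cmod u = 1\<close> by auto
    ultimately show False using nz[OF osg_scaleC[OF H b]] by simp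
  qed
  have lt: "cmod (h ((1 - x) ^ n)) < cmod (g ((1 - x) ^ n))" if x: "norm x < 1" for x n
  proof (rule ccontr)
    assume neg: "\<not> ?thesis"
    define k where "k t = cmod (g ((1 - t *\<^sub>R x) ^ n)) - cmod (h ((1 - t *\<^sub>R x) ^ n))" for t
    have "\<exists>t\<ge>0. t \<le> 1 \<and> k t = 0"
    proof (rule IVT2')
      show "k 1 \<le> 0" using neg by (simp add: k_def)
      show "0 \<le> k 0" by (simp add: k_def g1 h1)
      show "continuous_on {0..1} k"
        unfolding k_def by (intro continuous_intros g_cont h_cont)
    qed simp
    then obtain t where t: "0 \<le> t" "t \<le> 1" "k t = 0" by blast
    have "norm (t *\<^sub>R x) < 1" using t x mult_left_le_one_le[of "norm x" t] by simp
    then have "1 *\<^sub>C 1 + (- (t *\<^sub>R x)) \<in> H" by (intro osg_scalar_plus[OF H]) simp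
    then have "(1 - t *\<^sub>R x) ^ n \<in> H" by (intro osg_power[OF H]) simp
    from ne[OF this] t show False by (simp add: k_def)
  qed
  have g_mult: "g (x * y) = g x * g y" for x y
  proof (rule gleason_kahane_zelazko[OF g_add g_scale g1])
    show "g ((1 - x) ^ n) \<noteq> 0" if "norm x < 1" for x n using lt[OF that, of n] by auto
  qed
  have g_power: "g (x ^ n) = g x ^ n" for x n by (induction n) (simp_all add: g1 g_mult)
  have "h x = 0" for x
  proof -
    define z where "z = x - g x *\<^sub>C 1"
    have gz: "g z = 0" and hz: "h z = h x" by (simp_all add: z_def g.diff h.diff g_scale h_scale g1 h1)
    define r where "r = 1 / (norm z + 1)"
    have r: "r > 0" by (simp add: r_def add_nonneg_pos)
    have "norm z + 1 > 0" by (simp add: add_nonneg_pos)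
    then have rz: "r * norm z < 1" by (simp add: r_def pos_divide_less_eq)
    define y where "y = complex_of_real r *\<^sub>C z"
    have "real n * cmod (h y) \<le> 1" for n
    proof -
      define m where "m = n + 2"
      define w where "w = cis (2 * pi / real m)"
      have cw: "cmod (w ^ k) = 1" for k by (simp add: w_def norm_power)
      have "cmod (h (cnj (w ^ k) *\<^sub>C (1 + w ^ k *\<^sub>C y) ^ n)) \<le> 1" for k
      proof -
        have "norm (- (w ^ k *\<^sub>C y)) < 1" unfolding norm_minus_cancel norm_scaleC cw y_def using r rz by simp
        from lt[OF this, of n] have "cmod (h ((1 + w ^ k *\<^sub>C y) ^ n)) < 1"
          by (simp add: g_power g.add g_scale g1 y_def gz)
        then show ?thesis unfolding h_scale norm_mult complex_cnj_cnj cw by simp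
      qed
      then have "cmod (\<Sum>k<m. h (cnj (w ^ k) *\<^sub>C (1 + w ^ k *\<^sub>C y) ^ n)) \<le> (\<Sum>k<m. 1)"
        by (intro order_trans[OF norm_sum] sum_mono)
      moreover have "(\<Sum>k<m. cnj (w ^ k) *\<^sub>C (1 + w ^ k *\<^sub>C y) ^ n) = of_nat (m * n) *\<^sub>C y"
        unfolding w_def by (rule roots_of_unity_average) (simp add: m_def)
      ultimately have "cmod (h (of_nat (m * n) *\<^sub>C y)) \<le> real m" by (simp flip: h.sum)
      then have "real m * (real n * cmod (h y)) \<le> real m * 1"
        by (simp add: h_scale norm_mult mult_ac)
      then show ?thesis by (subst (asm) mult_le_cancel_left_pos) (auto simp: m_def)
    qed
    then have "cmod (h y) \<le> 0" by (rule bounded_multiples_imp_nonpos)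
    then show ?thesis using r hz by (simp add: y_def h_scale)
  qed
  then show ?thesis using g_mult f_gh by simp
qed

section \<open>Maximal ideals and the Jacobson radical\<close>

lemma left_ideal_mult: "left_ideal I \<Longrightarrow> x \<in> I \<Longrightarrow> a * x \<in> I"
  by (simp add: left_ideal_def)

lemma left_ideal_add: "left_ideal I \<Longrightarrow> x \<in> I \<Longrightarrow> y \<in> I \<Longrightarrow> x + y \<in> I"
  by (simp add: left_ideal_def)

lemma left_ideal_minus: "left_ideal I \<Longrightarrow> x \<in> I \<Longrightarrow> - x \<in> I"
  using left_ideal_mult[of I x "-1"] by simp

lemma left_ideal_diff: "left_ideal I \<Longrightarrow> x \<in> I \<Longrightarrow> y \<in> I \<Longrightarrow> x - y \<in> I"
  using left_ideal_add[of I x "-y"] left_ideal_minus[of I y] by simp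

lemma left_ideal_one: "left_ideal I \<Longrightarrow> 1 \<in> I \<Longrightarrow> I = UNIV"
  using left_ideal_mult[of I 1] by fastforce

lemma maximal_left_ideal_left: "maximal_left_ideal M \<Longrightarrow> left_ideal M"
  by (simp add: maximal_left_ideal_def)

lemma maximal_left_ideal_one: "maximal_left_ideal M \<Longrightarrow> 1 \<notin> M"
  using left_ideal_one by (auto simp: maximal_left_ideal_def)

lemma maximal_left_ideal_invertible:
  "maximal_left_ideal M \<Longrightarrow> x \<in> carrier invertible_group \<Longrightarrow> x \<notin> M"
  using maximal_left_ideal_one maximal_left_ideal_left left_ideal_mult invertibleE by metis

lemma left_ideal_adjoin:
  assumes M: "left_ideal M"
  shows "left_ideal {m + b * a |m b. m \<in> M}"
  unfolding left_ideal_def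
proof (intro conjI ballI allI)
  show "0 \<in> {m + b * a |m b. m \<in> M}"
    using M by (auto simp: left_ideal_def intro!: exI[of _ 0])
next
  fix x y assume "x \<in> {m + b * a |m b. m \<in> M}" "y \<in> {m + b * a |m b. m \<in> M}"
  then obtain m b m' b' where *: "x = m + b * a" "y = m' + b' * a" "m \<in> M" "m' \<in> M" by blast
  then have "x + y = (m + m') + (b + b') * a" by (simp add: algebra_simps)
  then show "x + y \<in> {m + b * a |m b. m \<in> M}" using * left_ideal_add[OF M] by blast
next
  fix c x assume "x \<in> {m + b * a |m b. m \<in> M}"
  then obtain m b where *: "x = m + b * a" "m \<in> M" by blast
  then have "c * x = c * m + (c * b) * a" by (simp add: algebra_simps)
  then show "c * x \<in> {m + b * a |m b. m \<in> M}" using * left_ideal_mult[OF M] by blast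
qed

lemma inverse_modulo_maximal_left_ideal:
  assumes M: "maximal_left_ideal M" and a: "a \<notin> M"
  obtains b where "b * a - 1 \<in> M"
proof -
  note lM = maximal_left_ideal_left[OF M]
  let ?J = "{m + b * a |m b. m \<in> M}"
  have "M \<subseteq> ?J"
  proof
    fix m assume "m \<in> M"
    then show "m \<in> ?J" by (intro CollectI exI[of _ m] exI[of _ 0]) simp
  qed
  moreover have "a \<in> ?J"
    using lM by (intro CollectI exI[of _ 0] exI[of _ 1]) (simp add: left_ideal_def)
  ultimately have "?J = UNIV"
    using M a left_ideal_adjoin[OF lM, of a] unfolding maximal_left_ideal_def by blast
  then obtain m b where "1 = m + b * a" "m \<in> M" by blast
  then have "b * a - 1 = - m" by (simp add: algebra_simps)
  then show ?thesis using that left_ideal_minus[OF lM \<open>m \<in> M\<close>] by metis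
qed

lemma exists_maximal_left_ideal:
  fixes I :: "'a::ring_1 set"
  assumes I: "left_ideal I" "1 \<notin> I"
  obtains M where "maximal_left_ideal M" "I \<subseteq> M"
proof -
  define \<J> where "\<J> = {J. left_ideal J \<and> I \<subseteq> J \<and> 1 \<notin> J}"
  have "\<exists>M\<in>\<J>. \<forall>X\<in>\<J>. M \<subseteq> X \<longrightarrow> X = M"
  proof (rule subset_Zorn_nonempty)
    show "\<J> \<noteq> {}" using I by (auto simp: \<J>_def)
    fix \<C> assume \<C>: "\<C> \<noteq> {}" "subset.chain \<J> \<C>"
    then have mem: "left_ideal J \<and> I \<subseteq> J \<and> 1 \<notin> J" if "J \<in> \<C>" for J
      using that by (auto simp: subset.chain_def \<J>_def)
    have lin: "J \<subseteq> J' \<or> J' \<subseteq> J" if "J \<in> \<C>" "J' \<in> \<C>" for J J'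
      using \<C> that by (auto simp: subset.chain_def)
    have "left_ideal (\<Union>\<C>)"
      unfolding left_ideal_def
    proof (intro conjI ballI allI)
      show "0 \<in> \<Union>\<C>" using \<C>(1) mem by (auto simp: left_ideal_def)
    next
      fix x y assume "x \<in> \<Union>\<C>" "y \<in> \<Union>\<C>"
      then obtain J J' where J: "J \<in> \<C>" "J' \<in> \<C>" "x \<in> J" "y \<in> J'" by blast
      from lin[OF J(1,2)] show "x + y \<in> \<Union>\<C>"
      proof
        assume "J \<subseteq> J'"
        then have "x + y \<in> J'" using J mem left_ideal_add by blast
        then show ?thesis using J by blast
      next
        assume "J' \<subseteq> J"
        then have "x + y \<in> J" using J mem left_ideal_add by blast
        then show ?thesis using J by blast
      qed
    next
      fix a x assume "x \<in> \<Union>\<C>"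
      then show "a * x \<in> \<Union>\<C>" using mem left_ideal_mult by blast
    qed
    then show "\<Union>\<C> \<in> \<J>" using mem \<C>(1) by (auto simp: \<J>_def)
  qed
  then obtain M where M: "M \<in> \<J>" "\<And>X. X \<in> \<J> \<Longrightarrow> M \<subseteq> X \<Longrightarrow> X = M" by blast
  have "maximal_left_ideal M"
    unfolding maximal_left_ideal_def
  proof (intro conjI allI impI)
    show "left_ideal M" "M \<noteq> UNIV" using M(1) by (auto simp: \<J>_def)
    fix J assume J: "left_ideal J \<and> M \<subseteq> J"
    show "J = M \<or> J = UNIV"
    proof (cases "1 \<in> J")
      case True then show ?thesis using J left_ideal_one by blast
    next
      case False
      then have "J \<in> \<J>" using J M(1) by (auto simp: \<J>_def)
      then show ?thesis using J M(2) by blast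
    qed
  qed
  then show ?thesis using that M(1) by (auto simp: \<J>_def)
qed

lemma jacobson_radicalI:
  assumes "\<And>y. \<exists>z. z * (1 + y * u) = 1"
  shows "u \<in> jacobson_radical"
  unfolding jacobson_radical_def
proof (intro InterI, clarify, rule ccontr)
  fix M assume M: "maximal_left_ideal M" "u \<notin> M"
  obtain b where "b * u - 1 \<in> M" using inverse_modulo_maximal_left_ideal[OF M] .
  then have "1 + (- b) * u \<in> M"
    using left_ideal_minus[OF maximal_left_ideal_left[OF M(1)], of "b * u - 1"] by simp
  then have "1 \<in> M"
    using assms[of "- b"] left_ideal_mult[OF maximal_left_ideal_left[OF M(1)]] by metis
  with maximal_left_ideal_one[OF M(1)] show False by blast
qed

lemma jacobson_radical_mult: "x \<in> jacobson_radical \<Longrightarrow> a * x \<in> jacobson_radical"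
  unfolding jacobson_radical_def using maximal_left_ideal_left left_ideal_mult by blast

text \<open>
  Otherwise the ideal generated by \<open>1 + x\<close> lies in a maximal ideal, which contains \<open>x\<close> too.
\<close>

lemma invertible_one_plus_radical:
  fixes x :: "'a::ring_1"
  assumes comm: "\<And>x y :: 'a. x * y = y * x" and x: "x \<in> jacobson_radical"
  shows "1 + x \<in> carrier invertible_group"
proof (rule ccontr)
  assume n: "1 + x \<notin> carrier invertible_group"
  let ?I = "{m + b * (1 + x) |m b. m \<in> {0}}"
  have "left_ideal {0::'a}" by (simp add: left_ideal_def)
  then have "left_ideal ?I" by (rule left_ideal_adjoin)
  moreover have "1 \<notin> ?I"
  proof
    assume "1 \<in> ?I"
    then obtain b where "b * (1 + x) = 1" by auto
    then show False using n invertibleI comm by metis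
  qed
  ultimately obtain M where M: "maximal_left_ideal M" "?I \<subseteq> M" by (rule exists_maximal_left_ideal)
  have "1 + x \<in> ?I" by (intro CollectI exI[of _ 0] exI[of _ 1]) simp
  then have "1 + x \<in> M" using M by blast
  moreover have "x \<in> M" using M x by (simp add: jacobson_radical_def)
  ultimately have "(1 + x) - x \<in> M"
    by (rule left_ideal_diff[OF maximal_left_ideal_left[OF M(1)]])
  then show False using maximal_left_ideal_one[OF M(1)] by simp
qed

section \<open>A Liouville theorem for seminorms\<close>

text \<open>
  Cauchy's argument for a function \<open>b\<close> that is holomorphic only modulo the kernel of a seminorm, as a
  choice of representatives in a quotient space is. Let \<open>h\<close> be the mean of \<open>b\<close> over \<open>N\<close> equidistant points
  of a circle about \<open>0\<close>. It equals \<open>b 0\<close> for radius \<open>0\<close> and is small for a suitable radius \<open>R\<close>.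
  Passing from \<open>0\<close> to \<open>R\<close> in \<open>N\<close> steps changes \<open>h\<close> by \<open>O(1/N)\<close> in total, because the
  radial derivative of the mean is a multiple of \<open>\<Sum>w\<^sup>k c(r w\<^sup>k)\<close>, which up to a second-order error is
  a telescoping sum of increments of \<open>b\<close> around the circle.
\<close>

lemma seminorm_liouville:
  fixes p :: "'a::complex_banach_algebra_1 \<Rightarrow> real" and b c :: "complex \<Rightarrow> 'a"
  assumes p_add: "\<And>x y. p (x + y) \<le> p x + p y" and p_scale: "\<And>z x. p (z *\<^sub>C x) = cmod z * p x"
    and diff: "\<And>l m. p (b m - b l - (m - l) *\<^sub>C c l) \<le> K * (cmod (m - l))\<^sup>2"
    and decay: "\<And>e. e > 0 \<Longrightarrow> \<exists>R>0. \<forall>l. cmod l = R \<longrightarrow> p (b l) \<le> e"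
  shows "p (b 0) \<le> 0"
proof (rule field_le_epsilon)
  fix e :: real assume "e > 0"
  then obtain R where R: "R > 0" "\<And>l. cmod l = R \<Longrightarrow> p (b l) \<le> e / 2"
    using decay[of "e / 2"] by auto
  have p0: "p 0 = 0" using p_scale[of 0 0] by simp
  have p_minus: "p (- x) = p x" for x
    using p_scale[of "-1" x] by (simp add: scaleC_minus_left)
  have p_sum: "p (\<Sum>i\<in>I. f i) \<le> (\<Sum>i\<in>I. p (f i))" for I :: "nat set" and f
  proof (induction I rule: infinite_finite_induct)
    case (insert i I)
    then show ?case using p_add[of "f i" "\<Sum>i\<in>I. f i"] by simp
  qed (simp_all add: p0)
  have K: "K \<ge> 0"
  proof -
    have "0 \<le> p x" for x using p_add[of x "- x"] p_minus[of x] p0 by simp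
    then have "0 \<le> p (b 1 - b 0 - (1 - 0) *\<^sub>C c 0)" .
    with diff[of 1 0] show ?thesis by simp
  qed
  have est: "p (b 0) \<le> e / 2 + K * R\<^sup>2 * (1 + 2 * pi) / real N" if N: "N \<ge> 2" for N
  proof -
    define w where "w = cis (2 * pi / real N)"
    define d where "d = R / real N"
    define h where "h j = complex_of_real (1 / real N) *\<^sub>C (\<Sum>k<N. b (complex_of_real (real j * d) * w ^ k))" for j
    have N0: "real N > 0" using N by simp
    have d: "d > 0" using R N0 by (simp add: d_def)
    have Nd: "real N * d = R" using N0 by (simp add: d_def)
    have cw: "cmod (w ^ k) = 1" for k by (simp add: w_def norm_power)
    have wN: "w ^ N = 1" unfolding w_def Complex.DeMoivre using N0 by simp
    have w1: "cmod (w - 1) \<le> 2 * pi / real N"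
    proof -
      have "cmod (w - 1) = 2 * \<bar>sin (pi / real N)\<bar>"
        using dist_exp_i_1[of "2 * pi / real N"] by (simp add: w_def cis_conv_exp)
      also have "\<dots> \<le> 2 * \<bar>pi / real N\<bar>" using abs_sin_x_le_abs_x[of "pi / real N"] by (intro mult_left_mono) simp_all
      finally show ?thesis by simp
    qed
    have w_ne: "w \<noteq> 1"
    proof
      assume "w = 1"
      then have "cis (2 * pi * real 1 / real N) = cis (2 * pi * real 0 / real N)" by (simp add: w_def)
      moreover have "inj_on (\<lambda>k. cis (2 * pi * real k / real N)) {..<N}"
        using Complex.bij_betw_roots_unity[of N] N by (simp add: bij_betw_def)
      ultimately have "(1::nat) = 0" using N inj_onD[of "\<lambda>k. cis (2 * pi * real k / real N)" "{..<N}" 1 0] by simp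
      then show False by simp
    qed
    have step: "p (h j - h (Suc j)) \<le> K * R\<^sup>2 * (1 + 2 * pi) / (real N)\<^sup>2" if j: "j < N" for j
    proof -
      \<comment> \<open>Expansion around the larger radius, because the telescoping argument needs \<open>r > 0\<close>.\<close>
      define r where "r = real (Suc j) * d"
      have r: "r > 0" using d by (simp add: r_def)
      have rR: "r \<le> R" unfolding r_def Nd[symmetric] using j d by (intro mult_right_mono) auto
      have rj: "real j * d - r = - d" by (simp add: r_def algebra_simps)
      define \<nu> where "\<nu> k = complex_of_real r * w ^ k" for k
      define \<mu> where "\<mu> k = complex_of_real (real j * d) * w ^ k" for k
      have \<mu>\<nu>: "\<mu> k - \<nu> k = - complex_of_real d * w ^ k" for k
        unfolding \<mu>_def \<nu>_def left_diff_distrib[symmetric] of_real_diff[symmetric] rj by simp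
      have \<nu>\<nu>: "\<nu> (Suc k) - \<nu> k = (complex_of_real r * (w - 1)) * w ^ k" for k
        by (simp add: \<nu>_def algebra_simps)
      define E where "E = (\<Sum>k<N. b (\<mu> k) - b (\<nu> k) - (\<mu> k - \<nu> k) *\<^sub>C c (\<nu> k))"
      define F where "F = (\<Sum>k<N. b (\<nu> (Suc k)) - b (\<nu> k) - (\<nu> (Suc k) - \<nu> k) *\<^sub>C c (\<nu> k))"
      define G where "G = (\<Sum>k<N. w ^ k *\<^sub>C c (\<nu> k))"
      have "p E \<le> (\<Sum>k<N. K * d\<^sup>2)"
        unfolding E_def using d
        by (intro order_trans[OF p_sum] sum_mono order_trans[OF diff]) (simp add: \<mu>\<nu> norm_mult cw)
      then have pE: "p E \<le> real N * (K * d\<^sup>2)" by simp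
      have "p F \<le> (\<Sum>k<N. K * (r * cmod (w - 1))\<^sup>2)"
        unfolding F_def using r
        by (intro order_trans[OF p_sum] sum_mono order_trans[OF diff]) (simp add: \<nu>\<nu> norm_mult cw)
      then have pF: "p F \<le> real N * (K * (r * cmod (w - 1))\<^sup>2)" by simp
      have "F = - ((complex_of_real r * (w - 1)) *\<^sub>C G)"
      proof -
        have "(\<Sum>k<N. b (\<nu> (Suc k)) - b (\<nu> k)) = b (\<nu> N) - b (\<nu> 0)"
          by (rule sum_lessThan_telescope)
        also have "\<dots> = 0" by (simp add: \<nu>_def wN)
        finally show ?thesis
          unfolding F_def G_def sum_subtractf \<nu>\<nu> scaleC_sum_right scaleC_scaleC by simp
      qed
      then have "(r * cmod (w - 1)) * p G = p F"
        using r by (simp add: p_minus p_scale norm_mult)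
      moreover have pos: "r * cmod (w - 1) > 0" using r w_ne by simp
      ultimately have "(r * cmod (w - 1)) * p G \<le> (r * cmod (w - 1)) * (real N * K * (r * cmod (w - 1)))"
        using pF by (simp add: power2_eq_square mult_ac)
      then have "p G \<le> real N * K * (r * cmod (w - 1))" using pos by (rule mult_left_le_imp_le)
      also have "\<dots> \<le> real N * K * (R * (2 * pi / real N))"
        using w1 rR r K R N0 by (intro mult_left_mono mult_mono) auto
      finally have pG: "p G \<le> 2 * pi * K * R" using N0 by (simp add: mult_ac)
      have "h j - h (Suc j) = complex_of_real (1 / real N) *\<^sub>C (E + - (complex_of_real d *\<^sub>C G))"
      proof -
        have "(\<Sum>k<N. b (\<mu> k)) - (\<Sum>k<N. b (\<nu> k)) = E + - (complex_of_real d *\<^sub>C G)"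
          unfolding E_def G_def \<mu>\<nu> scaleC_sum_right scaleC_scaleC
          by (simp add: sum_subtractf sum.distrib scaleC_minus_left sum_negf)
        then show ?thesis
          by (simp only: h_def \<mu>_def \<nu>_def r_def scaleC_diff_right[symmetric])
      qed
      then have "p (h j - h (Suc j)) = p (E + - (complex_of_real d *\<^sub>C G)) / real N"
        by (simp add: p_scale norm_divide)
      also have "\<dots> \<le> (p E + p (- (complex_of_real d *\<^sub>C G))) / real N"
        using N0 by (intro divide_right_mono p_add) auto
      also have "\<dots> \<le> (real N * (K * d\<^sup>2) + d * (2 * pi * K * R)) / real N"
        using N0 d pE pG by (intro divide_right_mono add_mono) (auto simp: p_minus p_scale)
      also have "\<dots> = K * R\<^sup>2 * (1 + 2 * pi) / (real N)\<^sup>2"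
        using N0 by (simp add: d_def power2_eq_square field_simps)
      finally show ?thesis .
    qed
    have "h 0 - h N = (\<Sum>j<N. h j - h (Suc j))"
      by (rule sum_lessThan_telescope'[symmetric])
    also have "p \<dots> \<le> (\<Sum>j<N. K * R\<^sup>2 * (1 + 2 * pi) / (real N)\<^sup>2)"
      by (intro order_trans[OF p_sum] sum_mono step) simp
    also have "\<dots> = K * R\<^sup>2 * (1 + 2 * pi) / real N"
      using N0 by (simp add: power2_eq_square)
    finally have "p (h 0 - h N) \<le> K * R\<^sup>2 * (1 + 2 * pi) / real N" .
    moreover have "p (h N) \<le> e / 2"
    proof -
      have "p (\<Sum>k<N. b (complex_of_real (real N * d) * w ^ k)) \<le> (\<Sum>k<N. e / 2)"
        using R cw by (intro order_trans[OF p_sum] sum_mono R(2)) (simp add: Nd norm_mult)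
      then show ?thesis using N0 by (simp add: h_def p_scale norm_divide field_simps)
    qed
    moreover have "h 0 = b 0"
    proof -
      have "h 0 = complex_of_real (1 / real N) *\<^sub>C (\<Sum>k<N. 1 *\<^sub>C b 0)" by (simp add: h_def)
      also have "\<dots> = b 0" unfolding scaleC_sum_left[symmetric] scaleC_scaleC using N0 by simp
      finally show ?thesis .
    qed
    ultimately show ?thesis using p_add[of "h 0 - h N" "h N"] by simp
  qed
  define C where "C = K * R\<^sup>2 * (1 + 2 * pi)"
  obtain N where N: "C / (e / 2) < real N" using reals_Archimedean2 by blast
  have "C \<le> (e / 2) * real N" using N \<open>e > 0\<close> by (simp add: field_simps)
  also have "\<dots> \<le> (e / 2) * real (N + 2)" using \<open>e > 0\<close> by (intro mult_left_mono) auto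
  finally have "C / real (N + 2) \<le> e / 2" by (simp add: pos_divide_le_eq)
  moreover have "p (b 0) \<le> e / 2 + C / real (N + 2)" unfolding C_def by (rule est) simp
  ultimately show "p (b 0) \<le> 0 + e" by linarith
qed

section \<open>Characters of a commutative Banach algebra\<close>

lemma infdist_approx:
  assumes "M \<noteq> {}" "e > 0"
  shows "\<exists>m\<in>M. dist x m < infdist x M + e"
  using assms cInf_lessD[of "dist x ` M" "infdist x M + e"] by (auto simp: infdist_notempty)

text \<open>
  The distance to an ideal is the norm of the quotient algebra, expressed on representatives.
\<close>

lemma
  fixes M :: "'a::complex_banach_algebra_1 set"
  assumes M: "left_ideal M"
  shows infdist_ideal_add: "infdist (x + y) M \<le> infdist x M + infdist y M"
    and infdist_ideal_mult: "(\<And>x y :: 'a. x * y = y * x) \<Longrightarrow> infdist (x * y) M \<le> infdist x M * infdist y M"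
    and infdist_ideal_norm: "infdist x M \<le> norm x"
    and infdist_ideal_mod: "x - y \<in> M \<Longrightarrow> infdist x M = infdist y M"
proof -
  have ne: "M \<noteq> {}" and zero: "0 \<in> M" using M by (auto simp: left_ideal_def)
  show norm: "infdist x M \<le> norm x" for x using infdist_le[OF zero, of x] by simp
  show add: "infdist (x + y) M \<le> infdist x M + infdist y M" for x y
  proof (rule field_le_epsilon)
    fix e :: real assume e: "e > 0"
    obtain m where m: "m \<in> M" "dist x m < infdist x M + e / 2" using infdist_approx[OF ne, of "e/2" x] e by auto
    obtain n where n: "n \<in> M" "dist y n < infdist y M + e / 2" using infdist_approx[OF ne, of "e/2" y] e by auto
    have "infdist (x + y) M \<le> dist (x + y) (m + n)" by (rule infdist_le) (rule left_ideal_add[OF M m(1) n(1)])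
    also have "\<dots> \<le> dist x m + dist y n" by (rule dist_triangle_add)
    finally show "infdist (x + y) M \<le> infdist x M + infdist y M + e" using m n by simp
  qed
  show "infdist x M = infdist y M" if xy: "x - y \<in> M"
  proof -
    have "y - x \<in> M" using left_ideal_minus[OF M xy] by simp
    then have "infdist (y - x) M = 0" "infdist (x - y) M = 0" using xy by (simp_all add: infdist_zero)
    then show ?thesis using add[of "x - y" y] add[of "y - x" x] by simp
  qed
  show "infdist (x * y) M \<le> infdist x M * infdist y M" if comm: "\<And>x y :: 'a. x * y = y * x"
  proof (rule field_le_epsilon)
    fix e :: real assume e: "e > 0"
    define q where "q = infdist x M + infdist y M + 1"
    define t where "t = min 1 (e / q)"
    have q: "q > 0" using infdist_nonneg[of x M] infdist_nonneg[of y M] by (simp add: q_def)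
    have t: "t > 0" "t \<le> 1" "t * q \<le> e" using e q by (auto simp: t_def min_def field_simps)
    obtain m where m: "m \<in> M" "dist x m < infdist x M + t" using infdist_approx[OF ne t(1)] by blast
    obtain n where n: "n \<in> M" "dist y n < infdist y M + t" using infdist_approx[OF ne t(1)] by blast
    have "y * m + (x - m) * n \<in> M" by (intro left_ideal_add[OF M] left_ideal_mult[OF M] m n)
    then have "infdist (x * y) M \<le> dist (x * y) (y * m + (x - m) * n)" by (rule infdist_le)
    also have "x * y - (y * m + (x - m) * n) = (x - m) * (y - n)"
      using comm[of y m] by (simp add: algebra_simps)
    then have "dist (x * y) (y * m + (x - m) * n) \<le> dist x m * dist y n"
      by (simp add: dist_norm norm_mult_ineq)
    also have "\<dots> \<le> (infdist x M + t) * (infdist y M + t)"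
      using m n infdist_nonneg[of x M] t by (intro mult_mono) auto
    also have "\<dots> = infdist x M * infdist y M + t * (infdist x M + infdist y M + t)"
      by (simp add: algebra_simps)
    also have "t * (infdist x M + infdist y M + t) \<le> t * q" using t by (simp add: q_def)
    finally show "infdist (x * y) M \<le> infdist x M * infdist y M + e" using t by simp
  qed
qed

text \<open>
  Maximal ideals are closed: the closure is again an ideal, and it is proper because the unit ball
  around \<open>1\<close> consists of invertible elements.
\<close>

lemma infdist_maximal_ideal_eq_0:
  fixes M :: "'a::complex_banach_algebra_1 set"
  assumes M: "maximal_left_ideal M"
    and comm: "\<And>x y :: 'a. x * y = y * x" and x: "infdist x M = 0"
  shows "x \<in> M"
proof -
  note lM = maximal_left_ideal_left[OF M]
  define Z where "Z = {x. infdist x M = 0}"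
  have zero: "x \<in> Z" if "infdist x M \<le> 0" for x using that infdist_nonneg[of x M] by (simp add: Z_def)
  have "left_ideal Z"
    unfolding left_ideal_def
  proof (intro conjI ballI allI)
    show "0 \<in> Z" using infdist_ideal_norm[OF lM, of 0] by (intro zero) simp
  next
    fix x y assume "x \<in> Z" "y \<in> Z"
    then show "x + y \<in> Z" using infdist_ideal_add[OF lM, of x y] by (intro zero) (simp add: Z_def)
  next
    fix a x assume "x \<in> Z"
    then show "a * x \<in> Z" using infdist_ideal_mult[OF lM comm, of a x] by (intro zero) (simp add: Z_def)
  qed
  moreover have "M \<subseteq> Z" by (auto simp: Z_def infdist_zero)
  moreover have "1 \<notin> Z"
  proof
    assume "1 \<in> Z"
    then obtain m where m: "m \<in> M" "dist 1 m < 1"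
      using infdist_approx[of M 1 1] lM by (auto simp: Z_def left_ideal_def)
    have "1 + (m - 1) \<in> carrier invertible_group"
      using m by (intro invertible_one_plus) (simp add: dist_norm norm_minus_commute)
    then show False using maximal_left_ideal_invertible[OF M] m by simp
  qed
  ultimately have "Z = M" using M unfolding maximal_left_ideal_def by blast
  then show ?thesis using x by (auto simp: Z_def)
qed

text \<open>
  If no \<open>a - l\<close> is in \<open>M\<close>, every \<open>a - l\<close> has an inverse \<open>b l\<close> modulo \<open>M\<close>. By the resolvent identity, \<open>b\<close> is
  holomorphic with derivative \<open>b\<^sup>2\<close> with respect to the quotient seminorm, and \<open>b l\<close> tends to \<open>0\<close> as
  \<open>l\<close> tends to infinity. So \<open>b 0\<close> is in \<open>M\<close>, which is impossible for an inverse modulo \<open>M\<close>.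
\<close>

lemma gelfand_mazur:
  fixes M :: "'a::complex_banach_algebra_1 set"
  assumes M: "maximal_left_ideal M" and comm: "\<And>x y :: 'a. x * y = y * x"
  shows "\<exists>l. a - l *\<^sub>C 1 \<in> M"
proof (rule ccontr)
  assume "\<not> ?thesis"
  then have "\<forall>l. \<exists>b. b * (a - l *\<^sub>C 1) - 1 \<in> M"
    using inverse_modulo_maximal_left_ideal[OF M] by metis
  then obtain b where b: "\<And>l. b l * (a - l *\<^sub>C 1) - 1 \<in> M" by metis
  note lM = maximal_left_ideal_left[OF M]
  define p where "p x = infdist x M" for x
  have p_add: "p (x + y) \<le> p x + p y" for x y unfolding p_def by (rule infdist_ideal_add[OF lM])
  have p_mult: "p (x * y) \<le> p x * p y" for x y unfolding p_def by (rule infdist_ideal_mult[OF lM comm])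
  have p_norm: "p x \<le> norm x" for x unfolding p_def by (rule infdist_ideal_norm[OF lM])
  have p_mod: "p x = p y" if "x - y \<in> M" for x y unfolding p_def by (rule infdist_ideal_mod[OF lM that])
  have p_nonneg: "0 \<le> p x" for x by (simp add: p_def infdist_nonneg)
  have p_scale_le: "p (z *\<^sub>C x) \<le> cmod z * p x" for z x
  proof -
    have "p (z *\<^sub>C x) \<le> p (z *\<^sub>C 1) * p x" using p_mult[of "z *\<^sub>C 1" x] by (simp add: scaleC_one_mult)
    also have "\<dots> \<le> cmod z * p x" using p_norm[of "z *\<^sub>C 1"] p_nonneg by (intro mult_right_mono) auto
    finally show ?thesis .
  qed
  have p_scale: "p (z *\<^sub>C x) = cmod z * p x" for z x
  proof (cases "z = 0")
    case True
    then show ?thesis using p_scale_le[of z x] p_nonneg[of "z *\<^sub>C x"] by simp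
  next
    case False
    then have "cmod z * p x \<le> p (z *\<^sub>C x)"
      using p_scale_le[of "inverse z" "z *\<^sub>C x"] unfolding norm_inverse by (simp add: scaleC_scaleC field_simps)
    with p_scale_le[of z x] show ?thesis by simp
  qed
  have p_minus: "p (- x) = p x" for x
    using p_scale[of "-1" x] by (simp add: scaleC_minus_left)
  define q where "q l = p (b l)" for l
  have q_nonneg: "0 \<le> q l" for l by (simp add: q_def p_nonneg)
  have resolvent: "(b m - b l) - (m - l) *\<^sub>C (b l * b m) \<in> M" for l m
  proof -
    define e where "e l = b l * (a - l *\<^sub>C 1) - 1" for l
    have "b l * e m - b m * e l \<in> M"
      using b by (intro left_ideal_diff[OF lM] left_ideal_mult[OF lM]) (simp_all add: e_def)
    also have "b l * e m = b l * b m * a - m *\<^sub>C (b l * b m) - b l"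
      by (simp add: e_def algebra_simps mult_scaleC_right)
    also have "b m * e l = b l * b m * a - l *\<^sub>C (b l * b m) - b m"
      using comm[of "b m" "b l"]
      by (simp add: e_def right_diff_distrib mult_scaleC_right mult.assoc[symmetric])
    finally show ?thesis by (simp add: scaleC_diff_left algebra_simps)
  qed
  have q_diff: "p (b m - b l) \<le> cmod (m - l) * (q l * q m)" for l m
  proof -
    have "p (b m - b l) = cmod (m - l) * p (b l * b m)"
      using p_mod[OF resolvent] p_scale by simp
    also have "\<dots> \<le> cmod (m - l) * (q l * q m)"
      unfolding q_def by (intro mult_left_mono p_mult) simp
    finally show ?thesis .
  qed
  have q_abs: "\<bar>q m - q l\<bar> \<le> cmod (m - l) * (q l * q m)" for l m
    using p_add[of "b m - b l" "b l"] p_add[of "b l - b m" "b m"] p_minus[of "b m - b l"] q_diff[of m l]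
    by (simp add: q_def abs_le_iff)
  have cont: "isCont q l" for l
  proof -
    define r where "r = 1 / (2 * (q l + 1))"
    have r: "r > 0" using q_nonneg[of l] by (simp add: r_def)
    have "\<bar>q m - q l\<bar> \<le> cmod (m - l) * (2 * (q l)\<^sup>2)" if m: "cmod (m - l) < r" for m
    proof -
      have "cmod (m - l) * q l \<le> r * q l" using m q_nonneg[of l] by (intro mult_right_mono) auto
      also have "\<dots> \<le> 1 / 2" using q_nonneg[of l] by (simp add: r_def field_simps)
      finally have "cmod (m - l) * q l * q m \<le> 1 / 2 * q m" using q_nonneg[of m] by (rule mult_right_mono)
      then have "q m \<le> 2 * q l" using q_abs[of m l] by (simp add: mult.assoc)
      then have "q l * q m \<le> q l * (2 * q l)" using q_nonneg[of l] by (rule mult_left_mono)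
      then have "cmod (m - l) * (q l * q m) \<le> cmod (m - l) * (2 * (q l)\<^sup>2)"
        by (intro mult_left_mono) (auto simp: power2_eq_square)
      with q_abs[of m l] show ?thesis by linarith
    qed
    then have "\<forall>\<^sub>F m in at l. norm (q m - q l) \<le> cmod (m - l) * (2 * (q l)\<^sup>2)"
      unfolding eventually_at using r by (intro exI[of _ r]) (auto simp: dist_norm)
    moreover have "((\<lambda>m. cmod (m - l) * (2 * (q l)\<^sup>2)) \<longlongrightarrow> cmod (l - l) * (2 * (q l)\<^sup>2)) (at l)"
      by (intro tendsto_intros)
    ultimately have "((\<lambda>m. q m - q l) \<longlongrightarrow> 0) (at l)"
      by (auto intro: Lim_null_comparison)
    then show ?thesis unfolding isCont_def by (simp add: LIM_zero_iff)
  qed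
  have far: "(cmod l - norm a) * q l \<le> 1" for l
  proof -
    have "l *\<^sub>C b l - (b l * a + - 1) = - (b l * (a - l *\<^sub>C 1) - 1)"
      by (simp add: algebra_simps mult_scaleC_right)
    then have "l *\<^sub>C b l - (b l * a + - 1) \<in> M" using left_ideal_minus[OF lM b] by metis
    then have "cmod l * q l = p (b l * a + - 1)" using p_mod p_scale unfolding q_def by metis
    also have "\<dots> \<le> p (b l * a) + p (- 1)" by (rule p_add)
    also have "\<dots> \<le> q l * norm a + 1"
    proof (intro add_mono)
      have "p (b l * a) \<le> q l * p a" using p_mult unfolding q_def .
      also have "\<dots> \<le> q l * norm a" using p_norm q_nonneg by (intro mult_left_mono)
      finally show "p (b l * a) \<le> q l * norm a" .
      show "p (- 1) \<le> 1" using p_norm[of "- 1"] by simp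
    qed
    finally show ?thesis by (simp add: algebra_simps)
  qed
  obtain K where K: "\<And>l. q l \<le> K"
  proof -
    have "compact (q ` cball 0 (norm a + 1))"
      by (intro compact_continuous_image continuous_at_imp_continuous_on ballI cont compact_cball)
    then obtain K where K: "\<And>l. cmod l \<le> norm a + 1 \<Longrightarrow> q l \<le> K"
      unfolding bounded_iff[symmetric] using compact_imp_bounded[THEN bounded_imp_bdd_above]
      by (fastforce simp: bdd_above_def)
    have "q l \<le> max K 1" for l
    proof (cases "cmod l \<le> norm a + 1")
      case False
      then have "1 * q l \<le> (cmod l - norm a) * q l" using q_nonneg[of l] by (intro mult_right_mono) auto
      with far[of l] show ?thesis by simp
    qed (use K in force)
    with that show ?thesis by blast
  qed
  have K0: "K \<ge> 0" using K[of 0] q_nonneg[of 0] by linarith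
  have "p (b 0) \<le> 0"
  proof (rule seminorm_liouville[OF p_add p_scale])
    fix l m
    have "b m - b l - (m - l) *\<^sub>C (b l * b l) - (m - l) *\<^sub>C (b l * (b m - b l)) \<in> M"
      using resolvent[of m l] by (simp add: algebra_simps scaleC_diff_right)
    then have "p (b m - b l - (m - l) *\<^sub>C (b l * b l)) = cmod (m - l) * p (b l * (b m - b l))"
      using p_mod p_scale by metis
    also have "\<dots> \<le> cmod (m - l) * (q l * (cmod (m - l) * (q l * q m)))"
    proof (intro mult_left_mono)
      have "p (b l * (b m - b l)) \<le> q l * p (b m - b l)" unfolding q_def by (rule p_mult)
      also have "\<dots> \<le> q l * (cmod (m - l) * (q l * q m))" using q_nonneg q_diff by (intro mult_left_mono)
      finally show "p (b l * (b m - b l)) \<le> q l * (cmod (m - l) * (q l * q m))" .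
    qed simp
    also have "\<dots> = (q l * q l * q m) * (cmod (m - l))\<^sup>2" by (simp add: power2_eq_square)
    also have "\<dots> \<le> (K * K * K) * (cmod (m - l))\<^sup>2"
      using K q_nonneg K0 by (intro mult_right_mono mult_mono) auto
    finally show "p (b m - b l - (m - l) *\<^sub>C (b l * b l)) \<le> (K * K * K) * (cmod (m - l))\<^sup>2" .
  next
    fix e :: real assume e: "e > 0"
    show "\<exists>R>0. \<forall>l. cmod l = R \<longrightarrow> p (b l) \<le> e"
    proof (intro exI[of _ "norm a + 1 / e"] conjI allI impI)
      show "norm a + 1 / e > 0" using e by (simp add: add_nonneg_pos)
      fix l assume "cmod l = norm a + 1 / e"
      with far[of l] e show "p (b l) \<le> e" by (simp add: q_def field_simps)
    qed
  qed
  then have "b 0 \<in> M"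
    using infdist_maximal_ideal_eq_0[OF M comm] p_nonneg[of "b 0"] by (simp add: p_def)
  then have "a * b 0 \<in> M" by (rule left_ideal_mult[OF lM])
  then have "a * b 0 - (b 0 * (a - 0 *\<^sub>C 1) - 1) \<in> M" using b left_ideal_diff[OF lM] by blast
  then have "1 \<in> M" by (simp add: comm[of a "b 0"])
  then show False using maximal_left_ideal_one[OF M] by simp
qed

definition character :: "('a::complex_banach_algebra_1 \<Rightarrow> complex) \<Rightarrow> bool" where
  "character \<phi> \<longleftrightarrow> (\<forall>x y. \<phi> (x + y) = \<phi> x + \<phi> y) \<and> (\<forall>c x. \<phi> (c *\<^sub>C x) = c * \<phi> x) \<and>
     (\<forall>x y. \<phi> (x * y) = \<phi> x * \<phi> y) \<and> \<phi> 1 = 1"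

lemma character_of_maximal_ideal:
  fixes M :: "'a::complex_banach_algebra_1 set"
  assumes M: "maximal_left_ideal M" and comm: "\<And>x y :: 'a. x * y = y * x"
  obtains \<phi> where "character \<phi>" "\<And>x. \<phi> x = 0 \<Longrightarrow> x \<in> M"
proof -
  note lM = maximal_left_ideal_left[OF M]
  obtain \<phi> where \<phi>: "\<And>x. x - \<phi> x *\<^sub>C 1 \<in> M" using gelfand_mazur[OF M comm] by metis
  have unique: "\<phi> x = l" if "x - l *\<^sub>C 1 \<in> M" for x l
  proof (rule ccontr)
    assume ne: "\<phi> x \<noteq> l"
    have "(x - l *\<^sub>C 1) - (x - \<phi> x *\<^sub>C 1) \<in> M" by (intro left_ideal_diff[OF lM] that \<phi>)
    then have "(\<phi> x - l) *\<^sub>C 1 \<in> M" by (simp add: scaleC_diff_left)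
    moreover have "(\<phi> x - l) *\<^sub>C (1::'a) \<in> carrier invertible_group"
      using ne by (intro invertible_scaleC invertibleI[of 1]) auto
    ultimately show False using maximal_left_ideal_invertible[OF M] by blast
  qed
  have "character \<phi>"
    unfolding character_def
  proof (intro conjI allI)
    fix x y c
    show "\<phi> (x + y) = \<phi> x + \<phi> y"
      using left_ideal_add[OF lM \<phi>[of x] \<phi>[of y]]
      by (intro unique) (simp add: scaleC_add_left algebra_simps)
    show "\<phi> (c *\<^sub>C x) = c * \<phi> x"
      using left_ideal_mult[OF lM \<phi>[of x], of "c *\<^sub>C 1"]
      by (intro unique) (simp add: scaleC_one_mult scaleC_diff_right scaleC_scaleC)
    show "\<phi> (x * y) = \<phi> x * \<phi> y"
    proof (rule unique)
      have "y * (x - \<phi> x *\<^sub>C 1) + (\<phi> x *\<^sub>C 1) * (y - \<phi> y *\<^sub>C 1) \<in> M"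
        by (intro left_ideal_add[OF lM] left_ideal_mult[OF lM] \<phi>)
      then show "x * y - (\<phi> x * \<phi> y) *\<^sub>C 1 \<in> M"
        using comm[of y x] by (simp add: scaleC_one_mult mult_scaleC_right scaleC_diff_right scaleC_scaleC algebra_simps)
    qed
    show "\<phi> 1 = 1" using lM by (intro unique) (simp add: left_ideal_def)
  qed
  moreover have "x \<in> M" if "\<phi> x = 0" for x using \<phi>[of x] that by simp
  ultimately show ?thesis using that by blast
qed

lemma characters_separate:
  fixes z :: "'a::complex_banach_algebra_1"
  assumes comm: "\<And>x y :: 'a. x * y = y * x" and ss: "(jacobson_radical :: 'a set) = {0}"
    and z: "\<And>\<phi> :: 'a \<Rightarrow> complex. character \<phi> \<Longrightarrow> \<phi> z = 0"
  shows "z = 0"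
proof -
  have "z \<in> M" if M: "maximal_left_ideal M" for M
    using character_of_maximal_ideal[OF M comm] z by metis
  then have "z \<in> jacobson_radical" by (auto simp: jacobson_radical_def)
  then have "z \<in> {0}" unfolding ss .
  then show ?thesis by simp
qed

lemma character_invertible:
  assumes \<phi>: "character \<phi>" and x: "x \<in> carrier invertible_group"
  shows "\<phi> x \<noteq> 0"
proof
  assume 0: "\<phi> x = 0"
  obtain y where "y * x = 1" using x by (rule invertibleE)
  then have "\<phi> y * \<phi> x = 1" using \<phi> unfolding character_def by metis
  with 0 show False by simp
qed

lemma character_le_norm:
  assumes \<phi>: "character \<phi>"
  shows "cmod (\<phi> x) \<le> norm x"
proof (rule ccontr)
  assume "\<not> ?thesis"
  then have "(- \<phi> x) *\<^sub>C 1 + x \<in> carrier invertible_group" by (intro invertible_scalar_plus) simp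
  from character_invertible[OF \<phi> this] \<phi> show False by (simp add: character_def)
qed

section \<open>Translations and the radical\<close>

text \<open>
  For given \<open>y\<close> choose a real \<open>l\<close> so large that \<open>b = l + y\<close> is in \<open>K\<close>. Then \<open>1 + y u = b (b\<^sup>-\<^sup>1 + u) - l u\<close>
  arises from \<open>b\<^sup>-\<^sup>1\<close> by operations under which \<open>K\<close> is closed, so it is invertible.
\<close>

lemma translation_invariant_imp_radical:
  fixes u :: "'b::complex_banach_algebra_1"
  assumes K: "open_subgroup_of_invertibles K"
    and inv: "\<And>b s. b \<in> K \<Longrightarrow> b + s *\<^sub>R u \<in> K"
  shows "u \<in> jacobson_radical"
proof (rule jacobson_radicalI)
  fix y :: 'b
  define l where "l = norm y + 1"
  define b where "b = l *\<^sub>R 1 + y"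
  have "complex_of_real l *\<^sub>C 1 + y \<in> K" by (intro osg_scalar_plus[OF K]) (simp add: l_def)
  then have b: "b \<in> K" by (simp add: b_def scaleC_of_real)
  obtain c where c: "c * b = 1" "b * c = 1" using osg_invertible[OF K b] by (rule invertibleE)
  have "c + 1 *\<^sub>R u \<in> K" using osg_inv[OF K b c] by (rule inv)
  then have "b * (c + u) \<in> K" using osg_mult[OF K b] by simp
  then have "b * (c + u) + (- l) *\<^sub>R u \<in> K" by (rule inv)
  also have "b * (c + u) + (- l) *\<^sub>R u = 1 + y * u"
    using c by (simp add: distrib_left) (simp add: b_def distrib_right)
  finally show "\<exists>z. z * (1 + y * u) = 1" using osg_invertible[OF K] invertibleE by metis
qed

text \<open>
  Both \<open>H\<close> and \<open>K\<close> are invariant under nonzero real factors, but the affine map is not homogeneous: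
  scaling \<open>b = \<Phi> a + u\<close> by \<open>t\<close> in \<open>K\<close> and then scaling the preimage by \<open>1/t\<close> in \<open>H\<close> leads to
  \<open>b + (1 - 1/t) u\<close> in \<open>K\<close>. The remaining translation by \<open>u\<close> itself is done in two halves.
\<close>

lemma affine_translation_in_radical:
  fixes T \<Phi> :: "'a::complex_banach_algebra_1 \<Rightarrow> 'b::complex_banach_algebra_1"
  assumes H: "open_subgroup_of_invertibles H" and K: "open_subgroup_of_invertibles K"
    and onto: "T ` H = K" and lin: "linear \<Phi>" and T: "\<And>a. a \<in> H \<Longrightarrow> T a = \<Phi> a + u"
  shows "u \<in> jacobson_radical"
proof (rule translation_invariant_imp_radical[OF K])
  have main: "b + s *\<^sub>R u \<in> K" if b: "b \<in> K" and s: "s \<noteq> 1" for b s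
  proof -
    define t where "t = 1 / (1 - s)"
    have t: "t \<noteq> 0" "1 / t = 1 - s" "(1 - s) * t = 1" using s by (simp_all add: t_def)
    have "t *\<^sub>R b \<in> K" by (rule osg_scaleR[OF K b t(1)])
    then obtain a where a: "a \<in> H" "\<Phi> a + u = t *\<^sub>R b" using onto T by (metis imageE)
    have "(1 / t) *\<^sub>R a \<in> H" using t(1) by (intro osg_scaleR[OF H a(1)]) simp
    then have "\<Phi> ((1 / t) *\<^sub>R a) + u \<in> K" using onto T by (metis imageI)
    also have "\<Phi> ((1 / t) *\<^sub>R a) = (1 / t) *\<^sub>R (t *\<^sub>R b - u)"
      unfolding a(2)[symmetric] linear_scale[OF lin] by simp
    also have "\<dots> = b - (1 - s) *\<^sub>R u" using t by (simp add: scaleR_diff_right)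
    finally show ?thesis by (simp add: scaleR_diff_left)
  qed
  fix b s assume b: "b \<in> K"
  show "b + s *\<^sub>R u \<in> K"
  proof (cases "s = 1")
    case True
    have "b + (1/2) *\<^sub>R u + (1/2) *\<^sub>R u \<in> K" by (intro main b) auto
    then show ?thesis using True by (simp add: add.assoc flip: scaleR_add_left)
  qed (rule main[OF b])
qed

text \<open>
  For \<open>x\<close> in the radical the line \<open>a + t x = a (1 + t a\<^sup>-\<^sup>1 x)\<close> consists of invertible elements, so it
  stays in \<open>H\<close> when \<open>a\<close> is in \<open>H\<close>.
\<close>

lemma linear_image_of_radical:
  fixes \<Phi> :: "'a::complex_banach_algebra_1 \<Rightarrow> 'b::complex_banach_algebra_1"
  assumes comm: "\<And>x y :: 'a. x * y = y * x"
    and H: "open_subgroup_of_invertibles H" and K: "open_subgroup_of_invertibles K"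
    and onto: "\<Phi> ` H = K" and lin: "linear \<Phi>" and x: "x \<in> jacobson_radical"
  shows "\<Phi> x \<in> jacobson_radical"
proof (rule translation_invariant_imp_radical[OF K])
  fix b s assume "b \<in> K"
  then obtain a where a: "a \<in> H" "b = \<Phi> a" using onto by blast
  have "range (\<lambda>t. a + t *\<^sub>R x) \<subseteq> H"
  proof (rule osg_connected[OF H])
    show "connected (range (\<lambda>t. a + t *\<^sub>R x))"
      by (intro connected_continuous_image continuous_intros) simp
    show "range (\<lambda>t. a + t *\<^sub>R x) \<subseteq> carrier invertible_group"
    proof clarify
      fix t
      obtain c where c: "c * a = 1" "a * c = 1" using osg_invertible[OF H a(1)] by (rule invertibleE)
      have "(t *\<^sub>R c) * x \<in> jacobson_radical" by (rule jacobson_radical_mult[OF x])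
      then have "1 + (t *\<^sub>R c) * x \<in> carrier invertible_group"
        by (rule invertible_one_plus_radical[OF comm])
      then have "a * (1 + (t *\<^sub>R c) * x) \<in> carrier invertible_group"
        by (rule invertible_mult[OF osg_invertible[OF H a(1)]])
      also have "a * (1 + (t *\<^sub>R c) * x) = a + t *\<^sub>R ((a * c) * x)"
        by (simp add: distrib_left mult.assoc)
      also have "\<dots> = a + t *\<^sub>R x" by (simp add: c)
      finally show "a + t *\<^sub>R x \<in> carrier invertible_group" .
    qed
    show "a \<in> range (\<lambda>t. a + t *\<^sub>R x)" by (rule range_eqI[of _ _ 0]) simp
  qed (rule a)
  then have "\<Phi> (a + s *\<^sub>R x) \<in> K" using onto by blast
  then show "b + s *\<^sub>R \<Phi> x \<in> K" by (simp add: a linear_add[OF lin] linear_scale[OF lin])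
qed

section \<open>Linear isometries and characters\<close>

text \<open>
  Let \<open>m = \<phi> (S l)\<close>. If \<open>\<bar>m\<bar> < \<bar>l\<bar>\<close>, the preimage \<open>y\<close> of the scalar \<open>m\<close> has norm less than \<open>\<bar>l\<bar>\<close>, so \<open>l - y\<close> is in \<open>K\<close>
  and \<open>S (l - y) = S l - m\<close> is invertible; but \<open>\<phi>\<close> vanishes there.
\<close>

lemma character_isometry_modulus:
  fixes S :: "'b::complex_banach_algebra_1 \<Rightarrow> 'a::complex_banach_algebra_1"
  assumes H: "open_subgroup_of_invertibles H" and K: "open_subgroup_of_invertibles K"
    and into: "S ` K \<subseteq> H" and lin: "linear S" and norm_S: "\<And>x. norm (S x) = norm x" and surj: "surj S"
    and \<phi>: "character \<phi>"
  shows "cmod (\<phi> (S (l *\<^sub>C 1))) = cmod l"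
proof (rule antisym)
  show "cmod (\<phi> (S (l *\<^sub>C 1))) \<le> cmod l"
    using character_le_norm[OF \<phi>, of "S (l *\<^sub>C 1)"] by (simp add: norm_S)
  show "cmod l \<le> cmod (\<phi> (S (l *\<^sub>C 1)))"
  proof (rule ccontr)
    assume less: "\<not> ?thesis"
    define m where "m = \<phi> (S (l *\<^sub>C 1))"
    obtain y where y: "S y = m *\<^sub>C 1" using surj by (metis surjD)
    have "norm y = cmod m" using norm_S[of y] y by simp
    then have "l *\<^sub>C 1 + - y \<in> K" using less by (intro osg_scalar_plus[OF K]) (simp add: m_def)
    then have "S (l *\<^sub>C 1 + - y) \<in> H" using into by blast
    moreover have "S (l *\<^sub>C 1 + - y) = S (l *\<^sub>C 1) + (- m) *\<^sub>C 1"
      unfolding linear_add[OF lin] linear_neg[OF lin] y scaleC_minus_left ..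
    ultimately have "S (l *\<^sub>C 1) + (- m) *\<^sub>C 1 \<in> carrier invertible_group"
      using osg_invertible[OF H] by metis
    from character_invertible[OF \<phi> this] show False
      using \<phi> by (simp add: character_def m_def)
  qed
qed

text \<open>
  The normalised functional \<open>f\<close> preserves the moduli of \<open>\<i>\<close> and \<open>1 + \<i>\<close> and fixes \<open>1\<close>, so it sends \<open>\<i>\<close> to \<open>\<i>\<close> or
  to \<open>-\<i>\<close>; in the second case its conjugate is considered.
\<close>

lemma character_isometry_multiplicative:
  fixes S :: "'b::complex_banach_algebra_1 \<Rightarrow> 'a::complex_banach_algebra_1"
  assumes H: "open_subgroup_of_invertibles H" and K: "open_subgroup_of_invertibles K"
    and into: "S ` K \<subseteq> H" and lin: "linear S" and norm_S: "\<And>x. norm (S x) = norm x" and surj: "surj S"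
    and \<phi>: "character \<phi>" and v: "v * S 1 = 1"
  shows "\<phi> (v * S (x * y)) = \<phi> (v * S x) * \<phi> (v * S y)"
proof -
  have \<phi>_mult: "\<phi> (a * b) = \<phi> a * \<phi> b" and \<phi>_add: "\<phi> (a + b) = \<phi> a + \<phi> b"
    and \<phi>_scale: "\<phi> (c *\<^sub>C a) = c * \<phi> a" and \<phi>_one: "\<phi> 1 = 1" for a b c
    using \<phi> by (simp_all add: character_def)
  have modulus: "cmod (\<phi> (S (l *\<^sub>C 1))) = cmod l" for l
    by (rule character_isometry_modulus[OF H K into lin norm_S surj \<phi>])
  define f where "f x = \<phi> (v * S x)" for x
  have f_one: "f 1 = 1" using v by (simp add: f_def \<phi>_one)
  have \<phi>v: "\<phi> v * \<phi> (S 1) = 1" using v \<phi>_mult \<phi>_one by metis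
  have "cmod (\<phi> (S 1)) = 1" using modulus[of 1] by simp
  then have "cmod (\<phi> v) = 1" using arg_cong[OF \<phi>v, of cmod] by (simp add: norm_mult)
  then have f_mod: "cmod (f (l *\<^sub>C 1)) = cmod l" for l
    by (simp add: f_def \<phi>_mult norm_mult modulus)
  have f_lin: "linear f"
  proof (rule linearI)
    show "f (r *\<^sub>R x) = r *\<^sub>R f x" for r x
      using \<phi>_scale[of "of_real r" "v * S x"]
      by (simp add: f_def linear_scale[OF lin] scaleC_of_real scaleR_conv_of_real[where 'a = complex])
  qed (simp add: f_def linear_add[OF lin] distrib_left \<phi>_add)
  have f_nz: "f b \<noteq> 0" if "b \<in> K" for b
  proof -
    have "S b \<in> carrier invertible_group" using that into osg_invertible[OF H] by blast
    then have "\<phi> (S b) \<noteq> 0" by (rule character_invertible[OF \<phi>])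
    moreover have "\<phi> v \<noteq> 0" using \<phi>v by auto
    ultimately show ?thesis by (simp add: f_def \<phi>_mult)
  qed
  define \<alpha> where "\<alpha> = f (\<i> *\<^sub>C 1)"
  have "f ((1 + \<i>) *\<^sub>C 1) = 1 + \<alpha>"
    by (simp add: scaleC_add_left linear_add[OF f_lin] f_one \<alpha>_def)
  then have "cmod (1 + \<alpha>) = cmod (1 + \<i>)" using f_mod by metis
  moreover have "cmod \<alpha> = 1" by (simp add: \<alpha>_def f_mod)
  ultimately have "(cmod (1 + \<alpha>))\<^sup>2 = 2" "(cmod \<alpha>)\<^sup>2 = 1" by (simp_all add: cmod_power2)
  then have eqs: "(1 + Re \<alpha>)\<^sup>2 + (Im \<alpha>)\<^sup>2 = 2" "(Re \<alpha>)\<^sup>2 + (Im \<alpha>)\<^sup>2 = 1"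
    by (simp_all add: cmod_power2)
  then have "Re \<alpha> = 0" by (simp add: power2_eq_square algebra_simps)
  moreover from this eqs(2) have "(Im \<alpha>)\<^sup>2 = 1" by simp
  ultimately consider "\<alpha> = \<i>" | "\<alpha> = - \<i>" by (auto simp: complex_eq_iff power2_eq_1_iff)
  then have "f (x * y) = f x * f y"
  proof cases
    case 1
    show ?thesis
      by (rule real_linear_gleason_kahane_zelazko[OF K f_lin f_one 1[unfolded \<alpha>_def] f_nz])
  next
    case 2
    have "linear (\<lambda>x. cnj (f x))"
      by (rule linearI) (simp_all add: linear_add[OF f_lin] linear_scale[OF f_lin])
    then have "cnj (f (x * y)) = cnj (f x) * cnj (f y)"
      by (rule real_linear_gleason_kahane_zelazko[OF K]) (use f_one 2 f_nz in \<open>auto simp: \<alpha>_def\<close>)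
    then show ?thesis by (metis complex_cnj_mult complex_cnj_cancel_iff)
  qed
  then show ?thesis by (simp add: f_def)
qed

section \<open>The isomorphism\<close>

lemma multiplicative_surj_one:
  fixes \<Psi> :: "'a::monoid_mult \<Rightarrow> 'b::monoid_mult"
  assumes "surj \<Psi>" "\<And>x y. \<Psi> (x * y) = \<Psi> x * \<Psi> y"
  shows "\<Psi> 1 = 1"
  using assms by (metis mult_1 mult_1_right surjD)

lemma isometric_algebra_iso_imp_group_iso:
  fixes \<Psi> :: "'a::{real_normed_algebra_1} \<Rightarrow> 'b::{real_normed_algebra_1}"
  assumes bij: "bij \<Psi>" and mult: "\<And>x y. \<Psi> (x * y) = \<Psi> x * \<Psi> y"
    and iso: "\<And>x y. norm (\<Psi> x - \<Psi> y) = norm (x - y)"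
  shows "isometrically_isomorphic (invertible_group :: 'a monoid) (invertible_group :: 'b monoid)"
proof -
  have one: "\<Psi> 1 = 1" using bij mult by (intro multiplicative_surj_one) (auto simp: bij_def)
  have inj: "\<Psi> x = \<Psi> y \<longleftrightarrow> x = y" for x y using bij by (auto simp: bij_def inj_def)
  have inv: "\<Psi> x \<in> carrier invertible_group \<longleftrightarrow> x \<in> carrier invertible_group" for x
  proof
    assume "\<Psi> x \<in> carrier invertible_group"
    then obtain y' where "y' * \<Psi> x = 1" "\<Psi> x * y' = 1" by (rule invertibleE)
    moreover obtain y where "y' = \<Psi> y" using surjD[OF bij_is_surj[OF bij]] by blast
    ultimately have "y * x = 1" "x * y = 1" by (metis mult one inj)+
    then show "x \<in> carrier invertible_group" by (rule invertibleI)
  next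
    assume "x \<in> carrier invertible_group"
    then obtain y where "y * x = 1" "x * y = 1" by (rule invertibleE)
    then have "\<Psi> y * \<Psi> x = 1" "\<Psi> x * \<Psi> y = 1" by (metis mult one)+
    then show "\<Psi> x \<in> carrier invertible_group" by (rule invertibleI)
  qed
  have "bij_betw \<Psi> (carrier invertible_group) (carrier invertible_group)"
    unfolding bij_betw_def
  proof
    show "inj_on \<Psi> (carrier invertible_group)" using inj by (auto simp: inj_on_def)
    show "\<Psi> ` carrier invertible_group = carrier invertible_group"
    proof (intro equalityI subsetI)
      fix y :: 'b assume y: "y \<in> carrier invertible_group"
      obtain x where "y = \<Psi> x" using surjD[OF bij_is_surj[OF bij]] by blast
      then show "y \<in> \<Psi> ` carrier invertible_group" using y inv by blast
    qed (use inv in blast)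
  qed
  then have "\<Psi> \<in> iso invertible_group invertible_group"
    using inv by (simp add: iso_def hom_def mult)
  then show ?thesis unfolding isometrically_isomorphic_def dist_norm using iso by blast
qed

theorem corollary5p2:
  fixes T :: "'a::complex_banach_algebra_1 \<Rightarrow> 'b::complex_banach_algebra_1"
    and \<AA> :: "'a set" and \<BB> :: "'b set"
  assumes comm_A: "\<forall>x y :: 'a. x * y = y * x"
    and semisimple_B: "(jacobson_radical :: 'b set) = {0}"
    and subgroup_A: "open_subgroup_of_invertibles \<AA>"
    and subgroup_B: "open_subgroup_of_invertibles \<BB>"
    and surj_T: "T ` \<AA> = \<BB>"
    and isometry_T: "\<forall>a\<in>\<AA>. \<forall>b\<in>\<AA>. norm (T a - T b) = norm (a - b)"
  shows "(\<exists>\<Phi> :: 'a \<Rightarrow> 'b.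
            (\<forall>a\<in>\<AA>. \<Phi> a = inv\<^bsub>invertible_group\<^esub> (T 1) * T a) \<and>
            bij \<Phi> \<and> linear \<Phi> \<and> (\<forall>x y. \<Phi> (x * y) = \<Phi> x * \<Phi> y) \<and>
            (\<forall>x y. norm (\<Phi> x - \<Phi> y) = norm (x - y)))
       \<and> (jacobson_radical :: 'a set) = {0}
       \<and> (\<forall>x y :: 'b. x * y = y * x)
       \<and> isometrically_isomorphic (invertible_group :: 'a monoid) (invertible_group :: 'b monoid)"
proof -
  have comm: "x * y = y * x" for x y :: 'a using comm_A by blast
  have isoT: "norm (T a - T b) = norm (a - b)" if "a \<in> \<AA>" "b \<in> \<AA>" for a b
    using isometry_T that by blast
  have "\<exists>\<Phi> u. linear \<Phi> \<and> (\<forall>x. norm (\<Phi> x) = norm x) \<and> surj \<Phi> \<and> (\<forall>a\<in>\<AA>. T a = \<Phi> a + u)"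
    by (rule isometry_between_open_subgroups_affine[OF subgroup_A subgroup_B surj_T isoT])
  then obtain \<Phi> u where lin: "linear \<Phi>" and norm_\<Phi>: "norm (\<Phi> x) = norm x"
    and surj: "surj \<Phi>" and T0: "a \<in> \<AA> \<Longrightarrow> T a = \<Phi> a + u" for x a
    by blast
  have "u \<in> jacobson_radical"
    by (rule affine_translation_in_radical[OF subgroup_A subgroup_B surj_T lin T0])
  then have "u = 0" unfolding semisimple_B by simp
  with T0 have T: "T a = \<Phi> a" if "a \<in> \<AA>" for a using that by simp
  have \<Phi>_onto: "\<Phi> ` \<AA> = \<BB>" using surj_T T by auto
  have inj: "inj \<Phi>"
    unfolding linear_injective_0[OF lin] using norm_\<Phi> by (metis norm_eq_zero)

  have ss_A: "(jacobson_radical :: 'a set) = {0}"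
  proof -
    have "x = 0" if "x \<in> jacobson_radical" for x :: 'a
    proof -
      have "\<Phi> x \<in> jacobson_radical"
        by (rule linear_image_of_radical[OF comm subgroup_A subgroup_B \<Phi>_onto lin that])
      then have "norm (\<Phi> x) = 0" unfolding semisimple_B by simp
      then show ?thesis by (simp add: norm_\<Phi>)
    qed
    moreover have "(0::'a) \<in> jacobson_radical"
      using maximal_left_ideal_left by (auto simp: jacobson_radical_def left_ideal_def)
    ultimately show ?thesis by blast
  qed

  define S where "S = inv_into UNIV \<Phi>"
  have \<Phi>S: "\<Phi> (S y) = y" and S\<Phi>: "S (\<Phi> x) = x" for x y
    using surj inj by (simp_all add: S_def surj_f_inv_f)
  have lin_S: "linear S"
    by (rule linearI; rule injD[OF inj]) (simp_all add: \<Phi>S linear_add[OF lin] linear_scale[OF lin])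
  have norm_S: "norm (S y) = norm y" for y using norm_\<Phi>[of "S y"] by (simp add: \<Phi>S)
  have surj_S: "surj S" by (rule surjI) (rule S\<Phi>)
  have S_into: "S ` \<BB> \<subseteq> \<AA>" using \<Phi>_onto S\<Phi> by force
  have "S 1 \<in> \<AA>" using S_into osg_one[OF subgroup_B] by blast
  then obtain v where v: "v * S 1 = 1" "S 1 * v = 1"
    by (rule invertibleE[OF osg_invertible[OF subgroup_A]])

  \<comment> \<open>\<open>R\<close> will turn out to be the inverse of the required isomorphism.\<close>
  define R where "R y = v * S y" for y
  have R_mult: "R (x * y) = R x * R y" for x y
  proof -
    have "R (x * y) - R x * R y = 0"
    proof (rule characters_separate[OF comm ss_A])
      fix \<phi> :: "'a \<Rightarrow> complex" assume \<phi>: "character \<phi>"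
      interpret additive \<phi> using \<phi> by unfold_locales (simp add: character_def)
      have "\<phi> (R (x * y)) = \<phi> (R x) * \<phi> (R y)"
        unfolding R_def
        by (rule character_isometry_multiplicative[OF subgroup_A subgroup_B S_into lin_S norm_S surj_S \<phi> v(1)])
      also have "\<dots> = \<phi> (R x * R y)" using \<phi> by (simp add: character_def)
      finally show "\<phi> (R (x * y) - R x * R y) = 0" by (simp add: diff)
    qed
    then show ?thesis by simp
  qed
  have R_one: "R 1 = 1" by (simp add: R_def v)
  have R_inj: "x = y" if "R x = R y" for x y
  proof -
    have "(S 1 * v) * S x = (S 1 * v) * S y" using that by (simp add: R_def mult.assoc)
    then have "\<Phi> (S x) = \<Phi> (S y)" by (simp add: v)
    then show ?thesis by (simp add: \<Phi>S)
  qed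
  have comm_B: "x * y = y * x" for x y :: 'b
    by (rule R_inj) (simp add: R_mult comm)

  have one_A: "1 \<in> \<AA>" by (rule osg_one[OF subgroup_A])
  define c where "c = T 1"
  have c: "c = \<Phi> 1" "c \<in> \<BB>" using T[OF one_A] surj_T one_A unfolding c_def by blast+
  obtain w where w: "w * c = 1" "c * w = 1"
    using osg_invertible[OF subgroup_B c(2)] by (rule invertibleE)
  have w_eq: "inv\<^bsub>invertible_group\<^esub> (T 1) = w"
    using group.inv_equality[OF group_invertible_group, of w c] w invertibleI[of w c] invertibleI[of c w]
    by (simp add: c_def)
  define \<Psi> where "\<Psi> x = w * \<Phi> x" for x
  have \<Phi>\<Psi>: "\<Phi> x = c * \<Psi> x" for x using w by (simp add: \<Psi>_def flip: mult.assoc)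
  have R\<Psi>: "R (\<Psi> x) = x" for x
  proof -
    have "R c = v" by (simp add: R_def c S\<Phi>)
    then have "R w * v = 1" using R_mult[of w c] w R_one by simp
    moreover have "R (\<Psi> x) = R w * v * x"
      by (simp add: \<Psi>_def R_mult mult.assoc) (simp add: R_def S\<Phi>)
    ultimately show ?thesis by simp
  qed
  then have \<Psi>R: "\<Psi> (R y) = y" for y using R_inj by metis
  have bij: "bij \<Psi>" using R\<Psi> \<Psi>R by (intro o_bij[of R]) (auto simp: fun_eq_iff)
  have mult: "\<Psi> (x * y) = \<Psi> x * \<Psi> y" for x y
    by (rule R_inj) (simp add: R\<Psi> R_mult)
  have lin_\<Psi>: "linear \<Psi>"
    by (rule linearI) (simp_all add: \<Psi>_def linear_add[OF lin] linear_scale[OF lin] distrib_left)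
  have norm_\<Psi>: "norm (\<Psi> x) = norm x" for x
  proof (rule antisym)
    have "norm c = 1" using norm_\<Phi>[of 1] c by simp
    then show "norm x \<le> norm (\<Psi> x)"
      using norm_\<Phi>[of x] \<Phi>\<Psi>[of x] norm_mult_ineq[of c "\<Psi> x"] by simp
    \<comment> \<open>Submultiplicativity of the norm of \<open>A\<close>, tested on a factor \<open>e\<close> for which \<open>\<Phi> (e x) = c \<Psi> e \<Psi> x\<close>
        reduces to \<open>\<Psi> x\<close>.\<close>
    define e where "e = R w"
    have e: "\<Psi> e = w" by (simp add: e_def \<Psi>R)
    have "\<Phi> (e * x) = \<Psi> x" unfolding \<Phi>\<Psi> mult e using w by (simp flip: mult.assoc)
    moreover have "norm e = 1" using norm_\<Phi>[of e] unfolding \<Phi>\<Psi> e w by simp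
    ultimately show "norm (\<Psi> x) \<le> norm x"
      using norm_\<Phi>[of "e * x"] norm_mult_ineq[of e x] by simp
  qed
  have iso: "norm (\<Psi> x - \<Psi> y) = norm (x - y)" for x y
    using norm_\<Psi>[of "x - y"] by (simp add: linear_diff[OF lin_\<Psi>])
  have ext: "\<Psi> a = inv\<^bsub>invertible_group\<^esub> (T 1) * T a" if "a \<in> \<AA>" for a
    using that by (simp add: \<Psi>_def w_eq T)
  show ?thesis
    by (intro conjI exI[of _ \<Psi>] ballI allI ext bij lin_\<Psi> mult iso ss_A comm_B
          isometric_algebra_iso_imp_group_iso[OF bij mult iso])
qed

end
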